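(* Suppose that the true density $f_0$ is in the Kullback-Leibler support of the prior $\Pi$, and let $\{A_n\}_{n=1}^\infty$ be a sequence of measurable subsets of $\mathbb F$. Then the following statements are equivalent. (i) There exists a constant $\beta_0>0$ such that $e^{n\beta_0}\,\Pi(A_n\mid X_1,\dots,X_n)\to 0$ in probability (with respect to $P_{f_0}^\infty$) as $n\to\infty$. (ii) There exists a constant $\beta_1>0$ such that $$P^\infty_{f_0}\big\{\Pi(A_n\mid X_1,\dots,X_n)> e^{-n\beta_1}\big\}\to 0\quad\text{as } n\to\infty.$$ (iii) There exist constants $0<\alpha_1\leq 1$, $\beta_2>0$ and a sequence $\{D_n\}_{n=1}^\infty$ of measurable sets $D_n\subset \mathbb X^n$ with $P^\infty_{f_0}(D_n)\to 0$ as $n\to\infty$ such that $$E_{f_0}\Big(1_{\mathbb X^n\setminus D_n}\int_{A_n}R_n(f)\,\Pi(df)\Big)^{\alpha_1}\leq e^{-n\beta_2}\quad\text{for all large } n.$$ (iv) For each $0<\alpha\leq 1$ there exist a constant $\beta_\alpha>0$ and a sequence $\{D_n\}_{n=1}^\infty$ of measurable sets $D_n\subset\mathbb X^n$ with $P^\infty_{f_0}(D_n)\to 0$ as $n\to\infty$ such that $$E_{f_0}\Big(1_{\mathbb X^n\setminus D_n}\int_{A_n}R_n(f)\,\Pi(df)\Big)^{\alpha}\leq e^{-n\beta_\alpha}\quad\text{for all large } n.$$ (v) There exist a constant $\beta_3>0$ and a sequence $\{D_n\}_{n=1}^\infty$ of measurable sets $D_n\subset\mathbb X^n$ such that $P^\infty_{f_0}(D_n)\to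 0$ as $n\to\infty$ and $$\int_{A_n}P^\infty_f(\mathbb X^n\setminus D_n)\,\Pi(df)\leq e^{-n\beta_3}\quad\text{for all large } n.$$
   Context: Setting. $\mathbb X$ is a Polish space with a $\sigma$-algebra $\mathcal X$ and $\mu$ is a $\sigma$-finite measure on $\mathbb X$. $\mathbb F$ is the space of probability densities with respect to $\mu$, assumed separable for the Hellinger metric $H(f,g)=\big(\int_{\mathbb X}(\sqrt{f}-\sqrt{g})^2\,d\mu\big)^{1/2}$, and equipped with its Borel $\sigma$-algebra $\mathcal F$. A prior $\Pi$ is a probability measure on $(\mathbb F,\mathcal F)$. Versions of densities are taken so that $(x,f)\mapsto f(x)$ is jointly measurable. $X_1,X_2,\dots$ are i.i.d. $\mathbb X$-valued with true density $f_0\in\mathbb F$. For a density $f$, $P_f$ is the distribution with density $f$ and $P_f^\infty$ is the infinite product of $P_f$ on $\mathbb X^\infty$. Likelihood ratio: $R_n(f)=\prod_{i=1}^n f(X_i)/f_0(X_i)$. Posterior: for measurable $A\subset\mathbb F$, $$\Pi(A\mid X_1,\dots,X_n)=\frac{\int_A\prod_{i=1}^n f(X_i)\,\Pi(df)}{\int_{\mathbb F}\prod_{i=1}^n f(X_i)\,\Pi(df)}=\frac{\int_A R_n(f)\,\Pi(df)}{\int_{\mathbb F}R_n(f)\,\Pi(df)}.$$ Kullback-Leibler divergence: $K(f,g)=\int_{\mathbb X} f\log(f/g)\,d\mu$. The density $f_0$ is in the Kullback-Leibler support of $\Pi$ if $\Pi(f: K(f_0,f)<\varepsilon)>0$ for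 every $\varepsilon>0$. For $D\subset\mathbb X^n$, $P_f^\infty(D)$ means $P_f^\infty\{(x_1,x_2,\dots): (x_1,\dots,x_n)\in D\}$, and $1_D$ is the indicator of $\{(X_1,\dots,X_n)\in D\}$. $E_{f_0}$ is expectation with respect to $X_1,\dots,X_n$ i.i.d. with density $f_0$. *)

theory Defs
  imports "HOL-Probability.Probability"
begin

definition is_density :: "'x measure \<Rightarrow> ('x \<Rightarrow> real) \<Rightarrow> bool" where
  "is_density M f \<longleftrightarrow>
     f \<in> borel_measurable M \<and> (\<forall>x\<in>space M. 0 \<le> f x) \<and> (\<integral>\<^sup>+x. ennreal (f x) \<partial>M) = 1"

text \<open>
  The space of densities consists of classes modulo equality almost everywhere, but likelihoods
  evaluate densities at points.  It is therefore represented by a set \<open>F\<close> that contains exactly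
  one version of every density.
\<close>

definition density_space :: "'x measure \<Rightarrow> ('x \<Rightarrow> real) set \<Rightarrow> bool" where
  "density_space M F \<longleftrightarrow>
     (\<forall>f\<in>F. is_density M f) \<and>
     (\<forall>g. is_density M g \<longrightarrow> (\<exists>!f. f \<in> F \<and> (AE x in M. f x = g x)))"

definition hellinger :: "'x measure \<Rightarrow> ('x \<Rightarrow> real) \<Rightarrow> ('x \<Rightarrow> real) \<Rightarrow> real" where
  "hellinger M f g = sqrt (\<integral>x. (sqrt (f x) - sqrt (g x))\<^sup>2 \<partial>M)"

lemma integrable_hellinger:
  assumes f: "is_density M f" and g: "is_density M g"
  shows "integrable M (\<lambda>x. (sqrt (f x) - sqrt (g x))\<^sup>2)"
proof -
  have int: "integrable M h" if "is_density M h" for h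
    using that by (intro integrableI_nonneg) (auto simp: is_density_def)
  have [measurable]: "f \<in> borel_measurable M" "g \<in> borel_measurable M"
    using f g by (auto simp: is_density_def)
  show ?thesis
  proof (rule Bochner_Integration.integrable_bound)
    show "integrable M (\<lambda>x. f x + g x)"
      using int[OF f] int[OF g] by auto
    show "AE x in M. norm ((sqrt (f x) - sqrt (g x))\<^sup>2) \<le> norm (f x + g x)"
    proof (rule AE_I2)
      fix x assume "x \<in> space M"
      then have nn: "f x \<ge> 0" "g x \<ge> 0" using f g by (auto simp: is_density_def)
      have "(sqrt (f x) - sqrt (g x))\<^sup>2 = f x + g x - 2 * (sqrt (f x) * sqrt (g x))"
        using nn by (simp add: power2_diff)
      moreover have "sqrt (f x) * sqrt (g x) \<ge> 0" using nn by simp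
      ultimately have "(sqrt (f x) - sqrt (g x))\<^sup>2 \<le> f x + g x"
        by linarith
      then show "norm ((sqrt (f x) - sqrt (g x))\<^sup>2) \<le> norm (f x + g x)"
        using nn by (simp only: real_norm_def abs_power2 abs_of_nonneg add_nonneg_nonneg)
    qed
  qed simp
qed

lemma L2_triangle:
  fixes a b :: "'x \<Rightarrow> real"
  assumes [measurable]: "a \<in> borel_measurable M" "b \<in> borel_measurable M"
    and a: "integrable M (\<lambda>x. (a x)\<^sup>2)" and b: "integrable M (\<lambda>x. (b x)\<^sup>2)"
  shows "sqrt (\<integral>x. (a x + b x)\<^sup>2 \<partial>M) \<le> sqrt (\<integral>x. (a x)\<^sup>2 \<partial>M) + sqrt (\<integral>x. (b x)\<^sup>2 \<partial>M)"
proof -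
  let ?A = "\<integral>x. (a x)\<^sup>2 \<partial>M" and ?B = "\<integral>x. (b x)\<^sup>2 \<partial>M" and ?C = "\<integral>x. \<bar>a x * b x\<bar> \<partial>M"
  have bnd: "\<bar>a x * b x\<bar> \<le> (a x)\<^sup>2 + (b x)\<^sup>2" for x
  proof -
    have "0 \<le> (\<bar>a x\<bar> - \<bar>b x\<bar>)\<^sup>2" by simp
    then have "2 * \<bar>a x * b x\<bar> \<le> (a x)\<^sup>2 + (b x)\<^sup>2" by (simp add: power2_diff abs_mult)
    then show ?thesis using abs_ge_zero[of "a x * b x"] by linarith
  qed
  have ab: "integrable M (\<lambda>x. a x * b x)"
  proof (rule Bochner_Integration.integrable_bound)
    show "integrable M (\<lambda>x. (a x)\<^sup>2 + (b x)\<^sup>2)" using a b by simp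
    show "AE x in M. norm (a x * b x) \<le> norm ((a x)\<^sup>2 + (b x)\<^sup>2)"
      by (intro AE_I2) (simp only: real_norm_def, use bnd in simp)
  qed simp
  have nn: "?A \<ge> 0" "?B \<ge> 0" "?C \<ge> 0" by simp_all
  have "(\<integral>\<^sup>+x. ennreal \<bar>a x\<bar> * ennreal \<bar>b x\<bar> \<partial>M)\<^sup>2
          \<le> (\<integral>\<^sup>+x. (ennreal \<bar>a x\<bar>)\<^sup>2 \<partial>M) * (\<integral>\<^sup>+x. (ennreal \<bar>b x\<bar>)\<^sup>2 \<partial>M)"
    by (rule Cauchy_Schwarz_nn_integral) auto
  moreover have "(\<integral>\<^sup>+x. ennreal \<bar>a x\<bar> * ennreal \<bar>b x\<bar> \<partial>M) = ennreal ?C"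
    using nn_integral_eq_integral[OF integrable_abs[OF ab]]
    by (simp add: abs_mult ennreal_mult)
  moreover have "(\<integral>\<^sup>+x. (ennreal \<bar>a x\<bar>)\<^sup>2 \<partial>M) = ennreal ?A"
    using a by (subst nn_integral_eq_integral[symmetric]) (auto simp: ennreal_power)
  moreover have "(\<integral>\<^sup>+x. (ennreal \<bar>b x\<bar>)\<^sup>2 \<partial>M) = ennreal ?B"
    using b by (subst nn_integral_eq_integral[symmetric]) (auto simp: ennreal_power)
  ultimately have "ennreal (?C\<^sup>2) \<le> ennreal (?A * ?B)"
    using nn by (simp add: ennreal_power ennreal_mult)
  then have "?C\<^sup>2 \<le> ?A * ?B" using nn by (subst (asm) ennreal_le_iff) auto
  then have "?C \<le> sqrt ?A * sqrt ?B"
    by (metis real_le_rsqrt real_sqrt_mult)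
  moreover have "(\<integral>x. a x * b x \<partial>M) \<le> ?C"
    by (rule integral_mono) (use ab in auto)
  moreover have "(\<integral>x. (a x + b x)\<^sup>2 \<partial>M) = ?A + ?B + 2 * (\<integral>x. a x * b x \<partial>M)"
    using a b ab by (simp add: power2_sum mult.assoc)
  ultimately have "(\<integral>x. (a x + b x)\<^sup>2 \<partial>M) \<le> (sqrt ?A + sqrt ?B)\<^sup>2"
    using nn by (simp add: power2_sum)
  then show ?thesis using nn by (intro real_le_lsqrt) auto
qed

lemma Metric_space_hellinger:
  assumes "density_space M F"
  shows "Metric_space F (hellinger M)"
proof
  have dens: "is_density M f" if "f \<in> F" for f
    using assms that by (auto simp: density_space_def)
  fix f g h
  show "0 \<le> hellinger M f g" by (simp add: hellinger_def)
  show "hellinger M f g = hellinger M g f" by (simp add: hellinger_def power2_commute)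
  assume f: "f \<in> F" and g: "g \<in> F"
  show "hellinger M f g = 0 \<longleftrightarrow> f = g"
  proof
    assume "hellinger M f g = 0"
    then have "AE x in M. (sqrt (f x) - sqrt (g x))\<^sup>2 = 0"
      using integral_nonneg_eq_0_iff_AE[OF integrable_hellinger[OF dens[OF f] dens[OF g]]]
      by (auto simp: hellinger_def)
    then have "AE x in M. f x = g x" by (rule eventually_mono) auto
    then show "f = g"
      using assms f g dens[OF g] by (auto simp: density_space_def)
  qed (simp add: hellinger_def)
  assume h: "h \<in> F"
  have [measurable]: "f \<in> borel_measurable M" "g \<in> borel_measurable M" "h \<in> borel_measurable M"
    using dens f g h by (auto simp: is_density_def)
  show "hellinger M f h \<le> hellinger M f g + hellinger M g h"
    using L2_triangle[of "\<lambda>x. sqrt (f x) - sqrt (g x)" M "\<lambda>x. sqrt (g x) - sqrt (h x)"]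
      integrable_hellinger[OF dens[OF f] dens[OF g]] integrable_hellinger[OF dens[OF g] dens[OF h]]
    by (simp add: hellinger_def)
qed

definition hellinger_topology :: "'x measure \<Rightarrow> ('x \<Rightarrow> real) set \<Rightarrow> ('x \<Rightarrow> real) topology" where
  "hellinger_topology M F = Metric_space.mtopology F (hellinger M)"

definition hellinger_borel :: "'x measure \<Rightarrow> ('x \<Rightarrow> real) set \<Rightarrow> ('x \<Rightarrow> real) measure" where
  "hellinger_borel M F = sigma F {U. openin (hellinger_topology M F) U}"

text \<open>
  The integrand of \<open>K(f, g)\<close> with the conventions \<open>0 log (0 / g) = 0\<close> and
  \<open>f log (f / 0) = \<infinity>\<close> for \<open>f > 0\<close>.  The integral is taken in the extended sense, as positive
  part minus negative part (the latter is finite because \<open>f log (f / g) \<ge> f - g\<close>); the library's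
  \<open>KL_divergence\<close> is a Bochner integral and would be \<open>0\<close> instead of \<open>\<infinity>\<close> for a non-integrable
  integrand.
\<close>

definition kl_integrand :: "real \<Rightarrow> real \<Rightarrow> ereal" where
  "kl_integrand a b = (if a = 0 then 0 else if b = 0 then \<infinity> else ereal (a * ln (a / b)))"

definition kl_div :: "'x measure \<Rightarrow> ('x \<Rightarrow> real) \<Rightarrow> ('x \<Rightarrow> real) \<Rightarrow> ereal" where
  "kl_div M f g =
     enn2ereal (\<integral>\<^sup>+x. e2ennreal (kl_integrand (f x) (g x)) \<partial>M) -
     enn2ereal (\<integral>\<^sup>+x. e2ennreal (- kl_integrand (f x) (g x)) \<partial>M)"

definition in_kl_support :: "'x measure \<Rightarrow> ('x \<Rightarrow> real) measure \<Rightarrow> ('x \<Rightarrow> real) \<Rightarrow> bool" where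
  "in_kl_support M prior f0 \<longleftrightarrow>
     (\<forall>\<epsilon>::real. \<epsilon> > 0 \<longrightarrow> measure prior {f \<in> space prior. kl_div M f0 f < ereal \<epsilon>} > 0)"

text \<open>
  A sample path is \<open>\<omega> :: nat \<Rightarrow> 'x\<close> and the observation \<open>X\<^sub>i\<close> is the coordinate \<open>\<omega> (i - 1)\<close>, so
  \<open>(X\<^sub>1, \<dots>, X\<^sub>n)\<close> is the restriction of \<open>\<omega>\<close> to \<open>{..<n}\<close>.
\<close>

definition path_measure :: "'x measure \<Rightarrow> ('x \<Rightarrow> real) \<Rightarrow> (nat \<Rightarrow> 'x) measure" where
  "path_measure M f = (\<Pi>\<^sub>M i\<in>(UNIV :: nat set). density M (\<lambda>x. ennreal (f x)))"

definition sample_space :: "'x measure \<Rightarrow> nat \<Rightarrow> (nat \<Rightarrow> 'x) measure" where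
  "sample_space M n = (\<Pi>\<^sub>M i\<in>{..<n}. M)"

definition sample_prob :: "'x measure \<Rightarrow> ('x \<Rightarrow> real) \<Rightarrow> nat \<Rightarrow> (nat \<Rightarrow> 'x) set \<Rightarrow> real" where
  "sample_prob M f n D =
     measure (path_measure M f) {\<omega> \<in> space (path_measure M f). restrict \<omega> {..<n} \<in> D}"

definition likelihood :: "nat \<Rightarrow> ('x \<Rightarrow> real) \<Rightarrow> (nat \<Rightarrow> 'x) \<Rightarrow> real" where
  "likelihood n f \<omega> = (\<Prod>i<n. f (\<omega> i))"

definition likelihood_ratio :: "('x \<Rightarrow> real) \<Rightarrow> nat \<Rightarrow> ('x \<Rightarrow> real) \<Rightarrow> (nat \<Rightarrow> 'x) \<Rightarrow> real" where
  "likelihood_ratio f0 n f \<omega> = (\<Prod>i<n. f (\<omega> i) / f0 (\<omega> i))"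

text \<open>
  The quotient never exceeds \<open>1\<close>; where the denominator is \<open>0\<close> or \<open>\<infinity>\<close> its value is \<open>0\<close>.
  When \<open>f\<^sub>0\<close> is in the Kullback-Leibler support this happens only on a null set of the true
  distribution.
\<close>

definition posterior ::
    "('x \<Rightarrow> real) measure \<Rightarrow> nat \<Rightarrow> (nat \<Rightarrow> 'x) \<Rightarrow> ('x \<Rightarrow> real) set \<Rightarrow> real" where
  "posterior prior n \<omega> A =
     enn2real ((\<integral>\<^sup>+f\<in>A. ennreal (likelihood n f \<omega>) \<partial>prior) /
               (\<integral>\<^sup>+f. ennreal (likelihood n f \<omega>) \<partial>prior))"

definition integrated_ratio ::
    "('x \<Rightarrow> real) measure \<Rightarrow> ('x \<Rightarrow> real) \<Rightarrow> nat \<Rightarrow> (nat \<Rightarrow> 'x) \<Rightarrow> ('x \<Rightarrow> real) set \<Rightarrow> ennreal" where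
  "integrated_ratio prior f0 n \<omega> A = (\<integral>\<^sup>+f\<in>A. ennreal (likelihood_ratio f0 n f \<omega>) \<partial>prior)"

text \<open>Powers of extended nonnegative numbers, for exponents \<open>a > 0\<close> only.\<close>

definition ennreal_powr :: "ennreal \<Rightarrow> real \<Rightarrow> ennreal" where
  "ennreal_powr x a = (if x = \<infinity> then \<infinity> else ennreal (enn2real x powr a))"

definition truncated_moment ::
    "'x measure \<Rightarrow> ('x \<Rightarrow> real) measure \<Rightarrow> ('x \<Rightarrow> real) \<Rightarrow> nat \<Rightarrow> ('x \<Rightarrow> real) set \<Rightarrow>
     (nat \<Rightarrow> 'x) set \<Rightarrow> real \<Rightarrow> ennreal" where
  "truncated_moment M prior f0 n A D a =
     (\<integral>\<^sup>+\<omega>. ennreal_powr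
            (indicator (space (sample_space M n) - D) (restrict \<omega> {..<n}) *
             integrated_ratio prior f0 n \<omega> A) a \<partial>path_measure M f0)"

definition tendsto_in_prob :: "'w measure \<Rightarrow> (nat \<Rightarrow> 'w \<Rightarrow> real) \<Rightarrow> real \<Rightarrow> bool" where
  "tendsto_in_prob P Y c \<longleftrightarrow>
     (\<forall>\<epsilon>>0. (\<lambda>n. measure P {\<omega> \<in> space P. \<bar>Y n \<omega> - c\<bar> > \<epsilon>}) \<longlonglongrightarrow> 0)"

text \<open>Measurable \<open>D\<^sub>n \<subseteq> X\<^sup>n\<close> for \<open>n \<ge> 1\<close> whose probability under the true density tends to \<open>0\<close>.\<close>

definition vanishing_sets :: "'x measure \<Rightarrow> ('x \<Rightarrow> real) \<Rightarrow> (nat \<Rightarrow> (nat \<Rightarrow> 'x) set) \<Rightarrow> bool" where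
  "vanishing_sets M f0 D \<longleftrightarrow>
     (\<forall>n\<ge>1. D n \<in> sets (sample_space M n)) \<and> (\<lambda>n. sample_prob M f0 n (D n)) \<longlonglongrightarrow> 0"

end

theory Submission
  imports Defs
begin

text \<open>
  The posterior mass of \<open>A n\<close> is the quotient of two integrated likelihood ratios, over \<open>A n\<close> and over the
  whole space.  Under the true distribution the denominator has expectation at most \<open>1\<close>, and because \<open>f0\<close>
  is in the Kullback-Leibler support, it is at least \<open>exp (- n c)\<close> with probability tending to \<open>1\<close>, for
  every \<open>c > 0\<close> (\<open>integrated_ratio_lower_bound\<close>).  On the exponential scale the denominator is therefore
  invisible, and the posterior mass is exponentially small exactly when the numerator is.
  
  The first two conditions differ only by a change of the rate.  If the posterior mass is exponentially small
  with high probability, then outside the exceptional samples the numerator is an exponentially small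
  multiple of the denominator, so its moments of all orders \<open>\<alpha> \<le> 1\<close> are exponentially small
  (\<open>moment_bound_of_posterior_decay\<close>).  Conversely, a bound on one such moment bounds the numerator by
  Markov's inequality (\<open>posterior_decay_of_moment_bound\<close>).
  
  The moment of order \<open>1\<close> is linear in the likelihood ratio, and Fubini together with the change of measure
  from \<open>f0\<close> to \<open>f\<close> turns it into the prior average of the probabilities of the complement of \<open>D n\<close>
  (\<open>truncated_integral\<close>).  The two sides differ only by samples at which \<open>f0\<close> vanishes, and such samples
  may be put into \<open>D n\<close>.
  
  The lower bound on the denominator is proved one density at a time: for \<open>f\<close> with divergence below \<open>c\<close> the
  weak law of large numbers gives a lower bound on the likelihood ratio, and the exceptional densities have
  small prior mass on average.
\<close>

section \<open>A weak law of large numbers for integrable variables\<close>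

text \<open>
  Independence holds because the law of finitely many coordinates under the infinite product is
  the finite product of their laws; it survives the application of \<open>z\<close> to each coordinate.
\<close>

lemma indep_vars_coordinates:
  fixes N :: "'a measure"
  assumes N: "prob_space N" and z: "z \<in> borel_measurable N" and J: "finite (J :: 'i set)"
  shows "prob_space.indep_vars (PiM UNIV (\<lambda>_. N)) (\<lambda>_. borel) (\<lambda>i \<omega>. z (\<omega> i)) J"
proof -
  interpret N: prob_space N by fact
  interpret product_prob_space "\<lambda>_. N" "UNIV :: 'i set" by unfold_locales
  have "P.indep_vars (\<lambda>_. N) (\<lambda>i \<omega>. \<omega> i) J" if "J \<noteq> {}"
  proof (subst P.indep_vars_iff_distr_eq_PiM'[OF that])
    show "distr (PiM UNIV (\<lambda>_. N)) (PiM J (\<lambda>_. N)) (\<lambda>x. \<lambda>i\<in>J. x i)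
        = (\<Pi>\<^sub>M i\<in>J. distr (PiM UNIV (\<lambda>_. N)) N (\<lambda>x. x i))"
      using distr_PiM_restrict_finite[OF J] PiM_component by (simp add: restrict_def)
  qed simp
  moreover have "P.indep_vars (\<lambda>_. N) (\<lambda>i \<omega>. \<omega> i) {}"
    by (simp add: P.indep_vars_def P.indep_sets_def)
  ultimately have "P.indep_vars (\<lambda>_. N) (\<lambda>i \<omega>. \<omega> i) J" by blast
  from P.indep_vars_compose2[OF this, of "\<lambda>_. z"] show ?thesis using z by simp
qed

text \<open>
  The exponential inequality of Hoeffding applies to bounded variables only.  Truncation at a high
  level reduces an integrable variable to a bounded one, at an arbitrarily small cost in \<open>L\<^sup>1\<close>.
\<close>

lemma integrable_truncation_approx:
  fixes y :: "'a \<Rightarrow> real"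
  assumes y: "integrable N y" and e: "0 < (e::real)"
  obtains k :: real where "k > 0" "(\<integral>x. \<bar>y x - max (- k) (min k (y x))\<bar> \<partial>N) < e"
proof -
  have [measurable]: "y \<in> borel_measurable N" using y by simp
  let ?u = "\<lambda>n x. \<bar>y x - max (- real n) (min (real n) (y x))\<bar>"
  have "(\<lambda>n. \<integral>x. ?u n x \<partial>N) \<longlonglongrightarrow> (\<integral>x. 0 \<partial>N)"
  proof (rule integral_dominated_convergence[where w = "\<lambda>x. \<bar>y x\<bar>"])
    show "AE x in N. (\<lambda>n. ?u n x) \<longlonglongrightarrow> 0"
    proof (rule AE_I2)
      fix x
      have "eventually (\<lambda>n. \<bar>y x\<bar> \<le> real n) sequentially"
        using eventually_ge_at_top[of "nat \<lceil>\<bar>y x\<bar>\<rceil>"] by eventually_elim linarith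
      then have "eventually (\<lambda>n. ?u n x = 0) sequentially"
        by eventually_elim (auto simp: min_def max_def)
      then show "(\<lambda>n. ?u n x) \<longlonglongrightarrow> 0" by (rule tendsto_eventually)
    qed
    show "AE x in N. norm (?u n x) \<le> \<bar>y x\<bar>" for n
      by (auto simp: min_def max_def)
  qed (use y in auto)
  then have "(\<lambda>n. \<integral>x. ?u n x \<partial>N) \<longlonglongrightarrow> 0" by simp
  from order_tendstoD(2)[OF this e] eventually_gt_at_top[of 0]
  have "eventually (\<lambda>n. (\<integral>x. ?u n x \<partial>N) < e \<and> n > 0) sequentially"
    by eventually_elim simp
  then obtain n where "(\<integral>x. ?u n x \<partial>N) < e" "n > 0"
    by (metis (no_types, lifting) eventually_sequentially le_refl)
  then show ?thesis using that[of "real n"] by simp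
qed

text \<open>
  Only a first moment is available for the log-likelihood ratio, so a proof by variances is not
  possible.  Write \<open>y\<close> as a bounded \<open>z\<close> plus a remainder of small \<open>L\<^sup>1\<close> norm: the averages of \<open>z\<close>
  concentrate exponentially fast, and the averages of the remainder are controlled by Markov's
  inequality, uniformly in \<open>n\<close>.
\<close>

lemma weak_law_of_large_numbers:
  fixes y :: "'a \<Rightarrow> real"
  assumes N: "prob_space N" and y: "integrable N y" and e: "\<epsilon> > 0"
  shows "(\<lambda>n. measure (PiM UNIV (\<lambda>_::nat. N))
      {\<omega> \<in> space (PiM UNIV (\<lambda>_. N)). real n * \<epsilon> \<le> \<bar>(\<Sum>i<n. y (\<omega> i)) - real n * (\<integral>x. y x \<partial>N)\<bar>})
    \<longlonglongrightarrow> 0"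
proof -
  interpret N: prob_space N by fact
  interpret product_prob_space "\<lambda>_. N" "UNIV :: nat set" by unfold_locales
  let ?P = "PiM UNIV (\<lambda>_::nat. N)"
  have [measurable]: "y \<in> borel_measurable N" using y by simp
  let ?E = "\<lambda>n. {\<omega> \<in> space ?P. real n * \<epsilon> \<le> \<bar>(\<Sum>i<n. y (\<omega> i)) - real n * (\<integral>x. y x \<partial>N)\<bar>}"
  have ev: "eventually (\<lambda>n. measure ?P (?E n) < \<delta>) sequentially" if \<delta>: "\<delta> > 0" for \<delta>
  proof -
    \<comment> \<open>The first bound keeps the means of \<open>y\<close> and \<open>z\<close> within \<open>\<epsilon> / 3\<close>; the second makes Markov's inequality
        for the remainder, at level \<open>\<epsilon> / 3\<close>, give at most \<open>\<delta> / 2\<close>.\<close>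
    define \<eta> where "\<eta> = min (\<epsilon> / 3) (\<epsilon> * \<delta> / 6)"
    have \<eta>: "\<eta> > 0" "\<eta> \<le> \<epsilon> / 3" "\<eta> \<le> \<epsilon> * \<delta> / 6" using e \<delta> by (auto simp: \<eta>_def)
    obtain k where k: "k > 0" "(\<integral>x. \<bar>y x - max (- k) (min k (y x))\<bar> \<partial>N) < \<eta>"
      using integrable_truncation_approx[OF y \<eta>(1)] by blast
    define z where "z x = max (- k) (min k (y x))" for x
    have [measurable]: "z \<in> borel_measurable N" unfolding z_def by simp
    have zb: "\<bar>z x\<bar> \<le> k" for x using k(1) by (auto simp: z_def)
    have zi: "integrable N z"
      by (rule N.integrable_const_bound[of _ k]) (use zb in auto)
    have yz: "(\<integral>x. \<bar>y x - z x\<bar> \<partial>N) < \<eta>" using k(2) by (simp add: z_def)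
    have mean: "\<bar>(\<integral>x. y x \<partial>N) - (\<integral>x. z x \<partial>N)\<bar> < \<epsilon> / 3"
      using integral_abs_bound[of N "\<lambda>x. y x - z x"] yz \<eta>(2) y zi by simp
    let ?Z = "\<lambda>n. {\<omega> \<in> space ?P. real n * (\<epsilon> / 3) \<le> \<bar>(\<Sum>i<n. z (\<omega> i)) - real n * (\<integral>x. z x \<partial>N)\<bar>}"
    let ?R = "\<lambda>n. {\<omega> \<in> space ?P. real n * (\<epsilon> / 3) \<le> (\<Sum>i<n. \<bar>y (\<omega> i) - z (\<omega> i)\<bar>)}"
    have int_coord: "(\<integral>\<omega>. g (\<omega> i) \<partial>?P) = (\<integral>x. g x \<partial>N)"
      "integrable N g \<Longrightarrow> integrable ?P (\<lambda>\<omega>. g (\<omega> i))" if [measurable]: "g \<in> borel_measurable N"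
      for g :: "'a \<Rightarrow> real" and i
    proof -
      have *: "distr ?P N (\<lambda>\<omega>. \<omega> i) = N" using PiM_component[of i] by simp
      show "(\<integral>\<omega>. g (\<omega> i) \<partial>?P) = (\<integral>x. g x \<partial>N)"
        using integral_distr[of "\<lambda>\<omega>. \<omega> i" ?P N g] * by simp
      show "integrable N g \<Longrightarrow> integrable ?P (\<lambda>\<omega>. g (\<omega> i))"
        using integrable_distr[of "\<lambda>\<omega>. \<omega> i" ?P N g] * by simp
    qed
    have Z: "measure ?P (?Z n) \<le> 2 * exp (- 2 * (real n * (\<epsilon> / 3))\<^sup>2 / (real n * (k - (- k))\<^sup>2))"
      if n: "n > 0" for n
    proof -
      interpret H: Hoeffding_ineq_iid ?P "{..<n}" "\<lambda>i \<omega>. z (\<omega> i)" "\<lambda>\<omega>. z (\<omega> 0)" "- k" k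
          "\<integral>x. z x \<partial>N"
      proof unfold_locales
        show "P.indep_vars (\<lambda>_. borel) (\<lambda>i \<omega>. z (\<omega> i)) {..<n}"
          by (rule indep_vars_coordinates) (use N in auto)
        have "distr ?P borel (\<lambda>\<omega>. z (\<omega> i)) = distr N borel z" for i
          using distr_distr[of z N borel "\<lambda>\<omega>. \<omega> i" ?P] PiM_component[of i] by (simp add: comp_def)
        then show "distr ?P borel (\<lambda>\<omega>. z (\<omega> i)) = distr ?P borel (\<lambda>\<omega>. z (\<omega> 0))" for i
          by simp
        have "(\<integral>\<omega>. z (\<omega> 0) \<partial>?P) = (\<integral>x. z x \<partial>N)" by (rule int_coord) simp
        then show "(\<integral>x. z x \<partial>N) \<equiv> (\<integral>\<omega>. z (\<omega> 0) \<partial>?P)" by simp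
        show "AE \<omega> in ?P. z (\<omega> 0) \<in> {- k..k}"
          using zb by (intro AE_I2) (auto simp: abs_le_iff minus_le_iff)
      qed auto
      show ?thesis
        using H.Hoeffding_ineq_abs_ge[of "real n * (\<epsilon> / 3)"] e k n by (simp add: lessThan_empty_iff)
    qed
    have R: "measure ?P (?R n) \<le> \<delta> / 2" if n: "n > 0" for n
    proof -
      have i: "integrable ?P (\<lambda>\<omega>. \<bar>y (\<omega> i) - z (\<omega> i)\<bar>)" for i
        by (rule int_coord(2)[of "\<lambda>x. \<bar>y x - z x\<bar>"]) (use y zi in auto)
      have "measure ?P (?R n) \<le> (\<integral>\<omega>. (\<Sum>i<n. \<bar>y (\<omega> i) - z (\<omega> i)\<bar>) \<partial>?P) / (real n * (\<epsilon> / 3))"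
        by (rule integral_Markov_inequality_measure[where A = "space ?P"])
           (use i n e in \<open>auto intro!: sum_nonneg\<close>)
      also have "(\<integral>\<omega>. (\<Sum>i<n. \<bar>y (\<omega> i) - z (\<omega> i)\<bar>) \<partial>?P) = real n * (\<integral>x. \<bar>y x - z x\<bar> \<partial>N)"
        using i int_coord(1)[of "\<lambda>x. \<bar>y x - z x\<bar>"] by simp
      also have "\<dots> / (real n * (\<epsilon> / 3)) = (\<integral>x. \<bar>y x - z x\<bar> \<partial>N) / (\<epsilon> / 3)"
        using n by simp
      also have "\<dots> \<le> (\<epsilon> * \<delta> / 6) / (\<epsilon> / 3)"
        using yz \<eta>(3) e by (intro divide_right_mono) auto
      finally show ?thesis using e by simp
    qed
    have sub: "?E n \<subseteq> ?Z n \<union> ?R n" if n: "n > 0" for n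
    proof
      fix \<omega> assume \<omega>: "\<omega> \<in> ?E n"
      show "\<omega> \<in> ?Z n \<union> ?R n"
      proof (rule ccontr)
        assume "\<omega> \<notin> ?Z n \<union> ?R n"
        then have a: "\<bar>(\<Sum>i<n. z (\<omega> i)) - real n * (\<integral>x. z x \<partial>N)\<bar> < real n * (\<epsilon> / 3)"
          and b: "(\<Sum>i<n. \<bar>y (\<omega> i) - z (\<omega> i)\<bar>) < real n * (\<epsilon> / 3)"
          using \<omega> by auto
        have c: "\<bar>(\<Sum>i<n. y (\<omega> i)) - (\<Sum>i<n. z (\<omega> i))\<bar> \<le> (\<Sum>i<n. \<bar>y (\<omega> i) - z (\<omega> i)\<bar>)"
          by (simp add: sum_subtractf[symmetric])
        have "\<bar>real n * (\<integral>x. y x \<partial>N) - real n * (\<integral>x. z x \<partial>N)\<bar> = real n * \<bar>(\<integral>x. y x \<partial>N) - (\<integral>x. z x \<partial>N)\<bar>"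
          by (simp add: right_diff_distrib[symmetric] abs_mult)
        also have "\<dots> < real n * (\<epsilon> / 3)" using mean n by simp
        finally have d: "\<bar>real n * (\<integral>x. y x \<partial>N) - real n * (\<integral>x. z x \<partial>N)\<bar> < real n * (\<epsilon> / 3)" .
        have "real n * \<epsilon> \<le> \<bar>(\<Sum>i<n. y (\<omega> i)) - real n * (\<integral>x. y x \<partial>N)\<bar>" using \<omega> by simp
        with a b c d show False by (simp add: field_simps abs_if split: if_splits)
      qed
    qed
    have lim: "(\<lambda>n. 2 * exp (- 2 * (real n * (\<epsilon> / 3))\<^sup>2 / (real n * (k - (- k))\<^sup>2))) \<longlonglongrightarrow> 0"
    proof (rule Lim_transform_eventually)
      define c where "c = \<epsilon>\<^sup>2 / (18 * k\<^sup>2)"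
      have "c > 0" using e k by (simp add: c_def)
      then have "\<bar>exp (- c)\<bar> < 1" by simp
      then have "(\<lambda>n. exp (- c) ^ n) \<longlonglongrightarrow> 0" by (intro LIMSEQ_power_zero) simp
      then show "(\<lambda>n. 2 * exp (- c) ^ n) \<longlonglongrightarrow> 0" by (rule tendsto_mult_right_zero)
      show "\<forall>\<^sub>F n in sequentially. 2 * exp (- c) ^ n =
          2 * exp (- 2 * (real n * (\<epsilon> / 3))\<^sup>2 / (real n * (k - (- k))\<^sup>2))"
        using eventually_gt_at_top[of 0]
      proof eventually_elim
        case (elim n)
        then show ?case using k e
          by (simp add: exp_of_nat_mult[symmetric] c_def power2_eq_square field_simps)
      qed
    qed
    have "eventually (\<lambda>n. 2 * exp (- 2 * (real n * (\<epsilon> / 3))\<^sup>2 / (real n * (k - (- k))\<^sup>2)) < \<delta> / 2) sequentially"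
      using order_tendstoD(2)[OF lim, of "\<delta> / 2"] \<delta> by simp
    with eventually_gt_at_top[of 0] show ?thesis
    proof eventually_elim
      case (elim n)
      have "measure ?P (?E n) \<le> measure ?P (?Z n \<union> ?R n)"
        using sub[OF elim(1)] by (intro P.finite_measure_mono) auto
      also have "\<dots> \<le> measure ?P (?Z n) + measure ?P (?R n)"
        by (rule measure_Un_le) auto
      also have "\<dots> < \<delta>" using Z[OF elim(1)] R[OF elim(1)] elim(2) by linarith
      finally show ?case .
    qed
  qed
  show ?thesis
    by (rule order_tendstoI) (use ev in \<open>auto intro!: always_eventually less_le_trans[OF _ measure_nonneg]\<close>)
qed

section \<open>Powers of extended nonnegative numbers\<close>

lemma ennreal_powr_one [simp]: "ennreal_powr x 1 = x"
  by (cases x) (auto simp: ennreal_powr_def)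

lemma ennreal_powr_mono: "x \<le> y \<Longrightarrow> 0 < a \<Longrightarrow> ennreal_powr x a \<le> ennreal_powr y a"
  by (cases x; cases y)
     (auto simp: ennreal_powr_def intro!: ennreal_leI powr_mono2 simp: top_unique)

lemma ennreal_powr_mult_const:
  "0 < c \<Longrightarrow> ennreal_powr (ennreal c * x) a = ennreal (c powr a) * ennreal_powr x a"
  by (cases x)
     (auto simp: ennreal_powr_def ennreal_mult_top ennreal_mult[symmetric] powr_mult)

text \<open>
  A crude substitute for Jensen's inequality \<open>E Y\<^sup>a \<le> (E Y)\<^sup>a\<close>: it bounds \<open>E Y\<^sup>a\<close> by \<open>1 + E Y\<close>, and constant
  factors do not matter next to exponentially small ones.
\<close>

lemma ennreal_powr_le_one_plus:
  assumes a: "0 < a" "a \<le> 1"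
  shows "ennreal_powr x a \<le> 1 + x"
proof (cases x)
  case (real r)
  have "r powr a \<le> 1 + r"
  proof (cases "r \<le> 1")
    case True
    then have "r powr a \<le> 1" using powr_mono2[of a r 1] a real by simp
    with real show ?thesis by simp
  next
    case False
    then have "r powr a \<le> r powr 1" using a by (intro powr_mono) auto
    with False show ?thesis by simp
  qed
  then have "ennreal (r powr a) \<le> ennreal (1 + r)" by (rule ennreal_leI)
  also have "\<dots> = 1 + ennreal r" using real by simp
  finally show ?thesis using real by (simp add: ennreal_powr_def)
qed (simp add: ennreal_powr_def)

lemma measurable_ennreal_powr [measurable]:
  assumes [measurable]: "h \<in> borel_measurable N"
  shows "(\<lambda>x. ennreal_powr (h x) a) \<in> borel_measurable N"
  unfolding ennreal_powr_def by measurable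

section \<open>Sample paths and change of measure\<close>

lemma prob_space_density_of_density:
  "is_density M f \<Longrightarrow> prob_space (density M (\<lambda>x. ennreal (f x)))"
  by (intro prob_spaceI) (auto simp: is_density_def emeasure_density cong: nn_integral_cong)

lemma is_density_measurable: "is_density M f \<Longrightarrow> f \<in> borel_measurable M"
  by (simp add: is_density_def)

lemma is_density_nonneg: "is_density M f \<Longrightarrow> x \<in> space M \<Longrightarrow> 0 \<le> f x"
  by (simp add: is_density_def)

lemma likelihood_restrict: "likelihood n f (restrict \<omega> {..<n}) = likelihood n f \<omega>"
  by (simp add: likelihood_def)

lemma likelihood_ratio_restrict:
  "likelihood_ratio f0 n f (restrict \<omega> {..<n}) = likelihood_ratio f0 n f \<omega>"
  by (simp add: likelihood_ratio_def)

lemma posterior_restrict: "posterior prior n (restrict \<omega> {..<n}) B = posterior prior n \<omega> B"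
  by (simp add: posterior_def likelihood_restrict)

lemma sets_path_measure:
  "sets (path_measure M f) = sets (PiM UNIV (\<lambda>_. M))"
  unfolding path_measure_def by (intro sets_PiM_cong) auto

lemma space_path_measure: "space (path_measure M f) = space (PiM UNIV (\<lambda>_. M))"
  by (rule sets_eq_imp_space_eq) (rule sets_path_measure)

lemma prob_space_path_measure: "is_density M f \<Longrightarrow> prob_space (path_measure M f)"
  unfolding path_measure_def by (intro prob_space_PiM prob_space_density_of_density)

lemma restrict_in_sample_space:
  "\<omega> \<in> space (path_measure M f) \<Longrightarrow> restrict \<omega> {..<n} \<in> space (sample_space M n)"
  by (auto simp: space_path_measure sample_space_def space_PiM)

lemma measurable_restrict_sample:
  "(\<lambda>\<omega>. restrict \<omega> {..<n}) \<in> measurable (path_measure M f) (sample_space M n)"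
proof -
  have "(\<lambda>\<omega>. restrict \<omega> {..<n}) \<in> measurable (PiM UNIV (\<lambda>_. M)) (PiM {..<n} (\<lambda>_. M))"
    by (rule measurable_restrict_subset) simp
  then show ?thesis
    unfolding sample_space_def by (subst measurable_cong_sets[OF sets_path_measure refl])
qed

lemma AE_path_coordinate:
  assumes f: "is_density M f" and ae: "AE x in density M (\<lambda>x. ennreal (f x)). Q x"
  shows "AE \<omega> in path_measure M f. Q (\<omega> i)"
  unfolding path_measure_def
  by (rule AE_PiM_component) (use ae prob_space_density_of_density[OF f] in auto)

lemma AE_density_pos:
  assumes f: "is_density M f"
  shows "AE x in density M (\<lambda>x. ennreal (f x)). 0 < f x"
  using is_density_measurable[OF f] by (subst AE_density) auto

lemma AE_path_pos:
  assumes f: "is_density M f"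
  shows "AE \<omega> in path_measure M f. \<forall>i<n. 0 < f (\<omega> i)"
proof -
  have "AE \<omega> in path_measure M f. \<forall>i\<in>{..<n}. 0 < f (\<omega> i)"
    by (intro eventually_ball_finite ballI AE_path_coordinate[OF f] AE_density_pos[OF f]) auto
  then show ?thesis by (rule eventually_mono) auto
qed

lemma measurable_sample_coordinate:
  "i < n \<Longrightarrow> (\<lambda>x. x i) \<in> measurable (sample_space M n) M"
  unfolding sample_space_def by simp

lemma measurable_likelihood:
  assumes f: "f \<in> borel_measurable M"
  shows "(\<lambda>x. ennreal (likelihood n f x)) \<in> borel_measurable (sample_space M n)"
  unfolding likelihood_def
proof (rule measurable_compose[OF _ measurable_ennreal], rule borel_measurable_prod)
  fix i assume "i \<in> {..<n}"
  then have "i < n" by simp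
  from measurable_compose[OF measurable_sample_coordinate[OF this] f]
  show "(\<lambda>x. f (x i)) \<in> borel_measurable (sample_space M n)" .
qed

lemma measurable_likelihood_ratio:
  assumes f0: "f0 \<in> borel_measurable M" and f: "f \<in> borel_measurable M"
  shows "(\<lambda>x. ennreal (likelihood_ratio f0 n f x)) \<in> borel_measurable (sample_space M n)"
  unfolding likelihood_ratio_def
proof (rule measurable_compose[OF _ measurable_ennreal], rule borel_measurable_prod)
  fix i assume "i \<in> {..<n}"
  then have "i < n" by simp
  from measurable_sample_coordinate[OF this]
  show "(\<lambda>x. f (x i) / f0 (x i)) \<in> borel_measurable (sample_space M n)"
    by (intro borel_measurable_divide measurable_compose[OF _ f] measurable_compose[OF _ f0])
qed

text \<open>
  The true density may vanish.  Likelihood ratios carry information about another density only on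
  this set of samples, to which the true distribution gives full probability.
\<close>

lemma sets_all_pos:
  fixes f :: "'a \<Rightarrow> real"
  assumes f: "f \<in> borel_measurable M"
  shows "{x \<in> space (sample_space M n). \<forall>i<n. 0 < f (x i)} \<in> sets (sample_space M n)"
proof -
  have "{x \<in> space (sample_space M n). \<forall>i\<in>{..<n}. 0 < f (x i)} \<in> sets (sample_space M n)"
  proof (rule sets.sets_Collect_finite_All)
    fix i assume "i \<in> {..<n}"
    then have "i < n" by simp
    from measurable_compose[OF measurable_sample_coordinate[OF this] f]
    show "{x \<in> space (sample_space M n). 0 < f (x i)} \<in> sets (sample_space M n)"
      by (rule borel_measurable_less[OF borel_measurable_const])
  qed auto
  then show ?thesis by (simp only: Ball_def lessThan_iff)
qed

text \<open>
  The joint density of \<open>n\<close> independent observations is the likelihood.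
\<close>

lemma density_product:
  assumes M: "sigma_finite_measure M" and f: "is_density M f"
  shows "PiM {..<n} (\<lambda>_. density M (\<lambda>x. ennreal (f x)))
    = density (sample_space M n) (\<lambda>x. ennreal (likelihood n f x))"
proof (rule sym)
  interpret M: sigma_finite_measure M by fact
  interpret product_sigma_finite "\<lambda>_::nat. M" by unfold_locales
  have [measurable]: "f \<in> borel_measurable M" by (rule is_density_measurable[OF f])
  interpret D: prob_space "density M (\<lambda>x. ennreal (f x))" by (rule prob_space_density_of_density[OF f])
  interpret D: product_sigma_finite "\<lambda>_::nat. density M (\<lambda>x. ennreal (f x))" by unfold_locales
  show "density (sample_space M n) (\<lambda>x. ennreal (likelihood n f x))
    = PiM {..<n} (\<lambda>_. density M (\<lambda>x. ennreal (f x)))"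
  proof (rule D.PiM_eqI)
    show "sets (density (sample_space M n) (\<lambda>x. ennreal (likelihood n f x)))
        = sets (PiM {..<n} (\<lambda>_. density M (\<lambda>x. ennreal (f x))))"
      by (simp add: sample_space_def cong: sets_PiM_cong)
    fix A :: "nat \<Rightarrow> 'a set" assume "\<And>i. i \<in> {..<n} \<Longrightarrow> A i \<in> sets (density M (\<lambda>x. ennreal (f x)))"
    then have A: "i < n \<Longrightarrow> A i \<in> sets M" for i by simp
    have PiA: "Pi\<^sub>E {..<n} A \<in> sets (sample_space M n)"
      unfolding sample_space_def by (rule sets_PiM_I_finite) (simp_all add: A)
    note L = measurable_likelihood[OF is_density_measurable[OF f]]
    have "emeasure (density (sample_space M n) (\<lambda>x. ennreal (likelihood n f x))) (Pi\<^sub>E {..<n} A)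
        = (\<integral>\<^sup>+x. ennreal (likelihood n f x) * indicator (Pi\<^sub>E {..<n} A) x \<partial>PiM {..<n} (\<lambda>_. M))"
      using emeasure_density[OF L PiA] by (simp only: sample_space_def)
    also have "\<dots> = (\<integral>\<^sup>+x. (\<Prod>i<n. ennreal (f (x i)) * indicator (A i) (x i)) \<partial>PiM {..<n} (\<lambda>_. M))"
    proof (rule nn_integral_cong)
      fix x assume x: "x \<in> space (PiM {..<n} (\<lambda>_. M))"
      have "indicator (Pi\<^sub>E {..<n} A) x = (\<Prod>i<n. indicator (A i) (x i) :: ennreal)"
      proof (cases "\<forall>i<n. x i \<in> A i")
        case True
        with x have "x \<in> Pi\<^sub>E {..<n} A" by (auto simp: space_PiM PiE_iff)
        with True show ?thesis by simp
      next
        case False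
        then obtain i where i: "i < n" "x i \<notin> A i" by blast
        then have "x \<notin> Pi\<^sub>E {..<n} A" by (auto simp: PiE_iff)
        moreover have "(\<Prod>i<n. indicator (A i) (x i) :: ennreal) = 0"
          by (rule prod_zero) (auto intro!: bexI[of _ i] simp: i)
        ultimately show ?thesis by simp
      qed
      moreover have "ennreal (likelihood n f x) = (\<Prod>i<n. ennreal (f (x i)))"
        using x unfolding likelihood_def
        by (subst prod_ennreal) (auto simp: space_PiM PiE_iff intro!: is_density_nonneg[OF f])
      ultimately show "ennreal (likelihood n f x) * indicator (Pi\<^sub>E {..<n} A) x
          = (\<Prod>i<n. ennreal (f (x i)) * indicator (A i) (x i))"
        by (simp add: prod.distrib)
    qed
    also have "\<dots> = (\<Prod>i<n. \<integral>\<^sup>+y. ennreal (f y) * indicator (A i) y \<partial>M)"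
      by (rule product_nn_integral_prod)
         (auto intro!: borel_measurable_times_ennreal borel_measurable_indicator A)
    also have "\<dots> = (\<Prod>i<n. emeasure (density M (\<lambda>x. ennreal (f x))) (A i))"
      by (intro prod.cong refl) (simp add: emeasure_density A)
    finally show "emeasure (density (sample_space M n) (\<lambda>x. ennreal (likelihood n f x))) (Pi\<^sub>E {..<n} A)
        = (\<Prod>i<n. emeasure (density M (\<lambda>x. ennreal (f x))) (A i))" .
  qed simp
qed

lemma nn_integral_path_sample:
  assumes M: "sigma_finite_measure M" and f: "is_density M f"
    and h [measurable]: "h \<in> borel_measurable (sample_space M n)"
  shows "(\<integral>\<^sup>+\<omega>. h (restrict \<omega> {..<n}) \<partial>path_measure M f)
    = (\<integral>\<^sup>+x. ennreal (likelihood n f x) * h x \<partial>sample_space M n)"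
proof -
  let ?N = "density M (\<lambda>x. ennreal (f x))"
  interpret N: prob_space ?N by (rule prob_space_density_of_density[OF f])
  interpret product_prob_space "\<lambda>_. ?N" "UNIV :: nat set" by unfold_locales
  have [measurable]: "f \<in> borel_measurable M" by (rule is_density_measurable[OF f])
  have s: "sets (PiM {..<n} (\<lambda>_. ?N)) = sets (sample_space M n)"
    unfolding sample_space_def by (intro sets_PiM_cong) auto
  have "(\<integral>\<^sup>+\<omega>. h (restrict \<omega> {..<n}) \<partial>path_measure M f)
      = (\<integral>\<^sup>+x. h x \<partial>distr (path_measure M f) (sample_space M n) (\<lambda>\<omega>. restrict \<omega> {..<n}))"
    by (rule nn_integral_distr[OF measurable_restrict_sample, symmetric])
       (simp only: measurable_distr_eq1 h)
  also have "distr (path_measure M f) (sample_space M n) (\<lambda>\<omega>. restrict \<omega> {..<n})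
      = distr (PiM UNIV (\<lambda>_. ?N)) (PiM {..<n} (\<lambda>_. ?N)) (\<lambda>\<omega>. restrict \<omega> {..<n})"
    unfolding path_measure_def by (intro distr_cong refl) (simp add: s)
  also have "\<dots> = PiM {..<n} (\<lambda>_. ?N)"
    by (rule distr_PiM_restrict_finite) auto
  also have "\<dots> = density (sample_space M n) (\<lambda>x. ennreal (likelihood n f x))"
    by (rule density_product[OF M f])
  also have "(\<integral>\<^sup>+x. h x \<partial>\<dots>) = (\<integral>\<^sup>+x. ennreal (likelihood n f x) * h x \<partial>sample_space M n)"
    by (rule nn_integral_density[OF measurable_likelihood[OF is_density_measurable[OF f]] h])
  finally show ?thesis .
qed

text \<open>
  Multiplying by the likelihood ratio turns an expectation under \<open>f0\<close> into one under \<open>f\<close>, except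
  that the part of \<open>f\<close> that is singular with respect to \<open>f0\<close> is lost.  Both sides are integrals
  against the product of the dominating measure; there the likelihood of \<open>f0\<close> cancels wherever
  it is positive.
\<close>

lemma change_of_measure:
  assumes M: "sigma_finite_measure M" and f: "is_density M f" and f0: "is_density M f0"
    and h [measurable]: "h \<in> borel_measurable (sample_space M n)"
  shows "(\<integral>\<^sup>+\<omega>. ennreal (likelihood_ratio f0 n f \<omega>) * h (restrict \<omega> {..<n}) \<partial>path_measure M f0)
    = (\<integral>\<^sup>+\<omega>. indicator {\<omega>. \<forall>i<n. 0 < f0 (\<omega> i)} \<omega> * h (restrict \<omega> {..<n}) \<partial>path_measure M f)"
proof -
  have fm: "f \<in> borel_measurable M" and f0m: "f0 \<in> borel_measurable M"
    by (rule is_density_measurable[OF f], rule is_density_measurable[OF f0])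
  let ?g = "\<lambda>x. indicator {\<omega>. \<forall>i<n. 0 < f0 (\<omega> i)} x :: ennreal"
  have "(\<integral>\<^sup>+\<omega>. ennreal (likelihood_ratio f0 n f \<omega>) * h (restrict \<omega> {..<n}) \<partial>path_measure M f0)
    = (\<integral>\<^sup>+\<omega>. ennreal (likelihood_ratio f0 n f (restrict \<omega> {..<n})) * h (restrict \<omega> {..<n}) \<partial>path_measure M f0)"
    by (simp add: likelihood_ratio_restrict)
  also have "\<dots> = (\<integral>\<^sup>+x. ennreal (likelihood n f0 x) * (ennreal (likelihood_ratio f0 n f x) * h x) \<partial>sample_space M n)"
    by (rule nn_integral_path_sample[OF M f0, where h = "\<lambda>x. ennreal (likelihood_ratio f0 n f x) * h x"])
       (rule borel_measurable_times_ennreal[OF measurable_likelihood_ratio[OF f0m fm] h])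
  also have "\<dots> = (\<integral>\<^sup>+x. ennreal (likelihood n f x) * (?g x * h x) \<partial>sample_space M n)"
  proof (rule nn_integral_cong)
    fix x assume "x \<in> space (sample_space M n)"
    then have x: "i < n \<Longrightarrow> x i \<in> space M" for i by (auto simp: sample_space_def space_PiM)
    have nn: "i < n \<Longrightarrow> 0 \<le> f0 (x i)" for i using is_density_nonneg[OF f0 x] .
    have l: "0 \<le> likelihood n f0 x" unfolding likelihood_def by (intro prod_nonneg) (use nn in auto)
    show "ennreal (likelihood n f0 x) * (ennreal (likelihood_ratio f0 n f x) * h x)
        = ennreal (likelihood n f x) * (?g x * h x)"
    proof (cases "\<forall>i<n. 0 < f0 (x i)")
      case True
      have "likelihood n f0 x * likelihood_ratio f0 n f x = likelihood n f x"
        unfolding likelihood_def likelihood_ratio_def prod.distrib[symmetric]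
        by (intro prod.cong refl) (use True in auto)
      with True l show ?thesis
        by (simp add: mult.assoc[symmetric] ennreal_mult'[symmetric])
    next
      case False
      then obtain i where i: "i < n" "\<not> 0 < f0 (x i)" by blast
      with nn[OF i(1)] have "f0 (x i) = 0" by simp
      with i(1) have "likelihood n f0 x = 0" unfolding likelihood_def by (intro prod_zero) auto
      with False show ?thesis by simp
    qed
  qed
  also have "\<dots> = (\<integral>\<^sup>+\<omega>. ?g (restrict \<omega> {..<n}) * h (restrict \<omega> {..<n}) \<partial>path_measure M f)"
  proof (rule nn_integral_path_sample[OF M f, where h = "\<lambda>x. ?g x * h x", symmetric])
    have "?g \<in> borel_measurable (sample_space M n)"
      using sets_all_pos[OF f0m, of n]
      by (subst borel_measurable_indicator_iff) (simp only: Collect_conj_eq Int_commute Collect_mem_eq)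
    then show "(\<lambda>x. ?g x * h x) \<in> borel_measurable (sample_space M n)"
      by (rule borel_measurable_times_ennreal[OF _ h])
  qed
  also have "\<dots> = (\<integral>\<^sup>+\<omega>. ?g \<omega> * h (restrict \<omega> {..<n}) \<partial>path_measure M f)"
    by (intro nn_integral_cong) (simp add: indicator_def)
  finally show ?thesis .
qed

section \<open>The log-likelihood ratio and the Kullback-Leibler divergence\<close>

text \<open>
  A finite divergence forces \<open>f > 0\<close> almost surely under \<open>f0\<close>, and then the extended integral in
  \<open>kl_div\<close> is an ordinary expectation.  The negative part is integrable in any case, because
  \<open>- a ln (a / b) = a ln (b / a) \<le> b - a \<le> b\<close>.
\<close>

lemma kl_div_log_ratio:
  assumes f: "is_density M f" and f0: "is_density M f0" and kl: "kl_div M f0 f < ereal c"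
  defines "N \<equiv> density M (\<lambda>x. ennreal (f0 x))"
  shows "AE x in N. 0 < f x" and "integrable N (\<lambda>x. ln (f0 x / f x))"
    and "(\<integral>x. ln (f0 x / f x) \<partial>N) < c"
proof -
  have [measurable]: "f \<in> borel_measurable M" "f0 \<in> borel_measurable M"
    by (rule is_density_measurable[OF f] is_density_measurable[OF f0])+
  have k [measurable]: "(\<lambda>x. kl_integrand (f0 x) (f x)) \<in> borel_measurable M"
    unfolding kl_integrand_def by measurable
  define p where "p = (\<integral>\<^sup>+x. e2ennreal (kl_integrand (f0 x) (f x)) \<partial>M)"
  define q where "q = (\<integral>\<^sup>+x. e2ennreal (- kl_integrand (f0 x) (f x)) \<partial>M)"
  have "q \<le> (\<integral>\<^sup>+x. ennreal (f x) \<partial>M)"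
    unfolding q_def
  proof (rule nn_integral_mono)
    fix x assume x: "x \<in> space M"
    have nn: "0 \<le> f x" "0 \<le> f0 x" using is_density_nonneg[OF f x] is_density_nonneg[OF f0 x] .
    show "e2ennreal (- kl_integrand (f0 x) (f x)) \<le> ennreal (f x)"
    proof (cases "0 < f0 x \<and> 0 < f x")
      case True
      then have "- (f0 x * ln (f0 x / f x)) = f0 x * ln (f x / f0 x)"
        by (simp add: ln_div algebra_simps)
      also have "\<dots> \<le> f0 x * (f x / f0 x - 1)"
        using True by (intro mult_left_mono ln_le_minus_one) auto
      also have "\<dots> \<le> f x" using True by (simp add: algebra_simps)
      finally show ?thesis using True by (simp add: kl_integrand_def ennreal_leI)
    qed (use nn in \<open>auto simp: kl_integrand_def e2ennreal_neg\<close>)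
  qed
  also have "\<dots> = 1" using f by (simp add: is_density_def)
  finally have q: "q \<le> 1" .
  then obtain q' where q': "q = ennreal q'" "0 \<le> q'" by (cases q) (auto simp: top_unique)
  have kl': "enn2ereal p - enn2ereal q < ereal c"
    using kl by (simp add: kl_div_def p_def q_def)
  have "p \<noteq> \<infinity>"
  proof
    assume "p = \<infinity>"
    then show False using kl' q' by simp
  qed
  then obtain p' where p': "p = ennreal p'" "0 \<le> p'" by (cases p) auto
  have c: "p' - q' < c" using kl' p' q' by simp
  have fin: "AE x in M. 0 < f0 x \<longrightarrow> 0 < f x"
  proof -
    have "AE x in M. e2ennreal (kl_integrand (f0 x) (f x)) \<noteq> \<infinity>"
      by (rule nn_integral_noteq_infinite) (use \<open>p \<noteq> \<infinity>\<close> in \<open>auto simp: p_def\<close>)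
    with AE_space show ?thesis
    proof eventually_elim
      case (elim x)
      then show ?case using is_density_nonneg[OF f, of x]
        by (auto simp: kl_integrand_def less_le)
    qed
  qed
  show "AE x in N. 0 < f x"
    unfolding N_def using fin by (subst AE_density) auto
  have int: "(\<integral>\<^sup>+x. ennreal (ln (f0 x / f x)) \<partial>N) = p"
    "(\<integral>\<^sup>+x. ennreal (- ln (f0 x / f x)) \<partial>N) = q"
  proof -
    show "(\<integral>\<^sup>+x. ennreal (ln (f0 x / f x)) \<partial>N) = p"
      unfolding N_def p_def
    proof (subst nn_integral_density, simp, simp, rule nn_integral_cong_AE)
      show "AE x in M. ennreal (f0 x) * ennreal (ln (f0 x / f x)) = e2ennreal (kl_integrand (f0 x) (f x))"
        using fin AE_space
      proof eventually_elim
        case (elim x)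
        then show ?case using is_density_nonneg[OF f0, of x]
          by (auto simp: kl_integrand_def less_le ennreal_mult'[symmetric])
      qed
    qed
    show "(\<integral>\<^sup>+x. ennreal (- ln (f0 x / f x)) \<partial>N) = q"
      unfolding N_def q_def
    proof (subst nn_integral_density, simp, simp, rule nn_integral_cong_AE)
      show "AE x in M. ennreal (f0 x) * ennreal (- ln (f0 x / f x)) = e2ennreal (- kl_integrand (f0 x) (f x))"
        using fin AE_space
      proof eventually_elim
        case (elim x)
        then show ?case using is_density_nonneg[OF f0, of x]
          by (auto simp: kl_integrand_def less_le ennreal_mult'[symmetric])
      qed
    qed
  qed
  show I: "integrable N (\<lambda>x. ln (f0 x / f x))"
    unfolding real_integrable_def int using p' q' by (simp add: N_def)
  show "(\<integral>x. ln (f0 x / f x) \<partial>N) < c"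
    using c p' q' by (simp add: real_lebesgue_integral_def[OF I] int)
qed

lemma ennreal_mult_divide_mult_cancel:
  fixes a b :: ennreal
  assumes "0 < c"
  shows "(ennreal c * a) / (ennreal c * b) = a / b"
proof (cases a; cases b)
  fix r s assume *: "a = ennreal r" "0 \<le> r" "b = ennreal s" "0 \<le> s"
  show ?thesis
  proof (cases "s = 0")
    case True
    then show ?thesis using * assms by (cases "r = 0") (auto simp: ennreal_mult[symmetric] divide_ennreal_def ennreal_mult_top)
  next
    case False
    then show ?thesis using * assms by (simp add: ennreal_mult[symmetric] divide_ennreal)
  qed
qed (use assms in \<open>auto simp: ennreal_mult_top divide_ennreal_def ennreal_mult[symmetric] ennreal_top_mult\<close>)

section \<open>Measurability and moments of the integrated likelihood ratio\<close>

text \<open>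
  Most arguments exchange an integral over the prior with one over the observations.  Joint measurability
  of evaluation in the point and the density is what makes Fubini's theorem available for likelihoods.
\<close>

locale density_model =
  fixes M :: "'x measure" and prior :: "('x \<Rightarrow> real) measure" and f0 :: "'x \<Rightarrow> real"
  assumes sigma_finite: "sigma_finite_measure M"
    and prob_prior: "prob_space prior"
    and is_density: "f \<in> space prior \<Longrightarrow> is_density M f"
    and measurable_eval: "(\<lambda>(x, f). f x) \<in> borel_measurable (M \<Otimes>\<^sub>M prior)"
    and is_density_true: "is_density M f0"
begin

abbreviation true_path :: "(nat \<Rightarrow> 'x) measure" where
  "true_path \<equiv> path_measure M f0"

sublocale prior: prob_space prior
  by (rule prob_prior)

sublocale true_path: prob_space true_path
  by (rule prob_space_path_measure[OF is_density_true])

sublocale pair: pair_prob_space true_path prior ..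

lemma measurable_eval_coordinate:
  assumes "i < n"
  shows "(\<lambda>z. snd z (fst z i)) \<in> borel_measurable (sample_space M n \<Otimes>\<^sub>M prior)"
proof -
  have "(\<lambda>z. (fst z i, snd z)) \<in> measurable (sample_space M n \<Otimes>\<^sub>M prior) (M \<Otimes>\<^sub>M prior)"
    by (rule measurable_Pair[OF measurable_compose[OF measurable_fst
          measurable_sample_coordinate[OF assms]] measurable_snd])
  from measurable_compose[OF this measurable_eval] show ?thesis by simp
qed

lemma measurable_joint_likelihood:
  "(\<lambda>z. ennreal (likelihood n (snd z) (fst z))) \<in> borel_measurable (sample_space M n \<Otimes>\<^sub>M prior)"
  unfolding likelihood_def
  by (rule measurable_compose[OF _ measurable_ennreal], rule borel_measurable_prod,
      rule measurable_eval_coordinate) (simp only: lessThan_iff)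

lemma measurable_joint_ratio:
  "(\<lambda>z. likelihood_ratio f0 n (snd z) (fst z)) \<in> borel_measurable (sample_space M n \<Otimes>\<^sub>M prior)"
  unfolding likelihood_ratio_def
proof (rule borel_measurable_prod)
  fix i assume "i \<in> {..<n}"
  then have i: "i < n" by simp
  have "(\<lambda>z. f0 (fst z i)) \<in> borel_measurable (sample_space M n \<Otimes>\<^sub>M prior)"
    by (rule measurable_compose[OF measurable_compose[OF measurable_fst
          measurable_sample_coordinate[OF i]] is_density_measurable[OF is_density_true]])
  with measurable_eval_coordinate[OF i]
  show "(\<lambda>z. snd z (fst z i) / f0 (fst z i)) \<in> borel_measurable (sample_space M n \<Otimes>\<^sub>M prior)"
    by (rule borel_measurable_divide)
qed

lemma measurable_path_ratio:
  "(\<lambda>z. likelihood_ratio f0 n (snd z) (fst z)) \<in> borel_measurable (true_path \<Otimes>\<^sub>M prior)"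
proof -
  have "(\<lambda>z. (restrict (fst z) {..<n}, snd z))
      \<in> measurable (true_path \<Otimes>\<^sub>M prior) (sample_space M n \<Otimes>\<^sub>M prior)"
    by (rule measurable_Pair[OF measurable_compose[OF measurable_fst measurable_restrict_sample]
          measurable_snd])
  from measurable_compose[OF this measurable_joint_ratio] show ?thesis
    by (simp only: fst_conv snd_conv likelihood_ratio_restrict)
qed

lemma measurable_prior_ratio:
  assumes "\<omega> \<in> space true_path"
  shows "(\<lambda>f. likelihood_ratio f0 n f \<omega>) \<in> borel_measurable prior"
  using measurable_compose[OF measurable_Pair1'[OF assms] measurable_path_ratio] by simp

lemma measurable_integrated_ratio:
  assumes B: "B \<in> sets prior"
  shows "(\<lambda>\<omega>. integrated_ratio prior f0 n \<omega> B) \<in> borel_measurable true_path"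
  unfolding integrated_ratio_def
proof (rule prior.borel_measurable_nn_integral)
  have "(\<lambda>z. ennreal (likelihood_ratio f0 n (snd z) (fst z)) * indicator B (snd z))
      \<in> borel_measurable (true_path \<Otimes>\<^sub>M prior)"
    by (intro borel_measurable_times_ennreal measurable_compose[OF measurable_path_ratio measurable_ennreal]
        measurable_compose[OF measurable_snd borel_measurable_indicator[OF B]])
  then show "(\<lambda>(\<omega>, f). ennreal (likelihood_ratio f0 n f \<omega>) * indicator B f)
      \<in> borel_measurable (true_path \<Otimes>\<^sub>M prior)"
    by (simp only: split_beta')
qed

lemma measurable_posterior_sample:
  assumes B: "B \<in> sets prior"
  shows "(\<lambda>x. posterior prior n x B) \<in> borel_measurable (sample_space M n)"
proof -
  have "(\<lambda>x. \<integral>\<^sup>+f. ennreal (likelihood n f x) * indicator C f \<partial>prior) \<in> borel_measurable (sample_space M n)"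
    if C: "C \<in> sets prior" for C
  proof (rule prior.borel_measurable_nn_integral)
    have "(\<lambda>z. ennreal (likelihood n (snd z) (fst z)) * indicator C (snd z))
        \<in> borel_measurable (sample_space M n \<Otimes>\<^sub>M prior)"
      by (intro borel_measurable_times_ennreal measurable_joint_likelihood
          measurable_compose[OF measurable_snd borel_measurable_indicator[OF C]])
    then show "(\<lambda>(x, f). ennreal (likelihood n f x) * indicator C f)
        \<in> borel_measurable (sample_space M n \<Otimes>\<^sub>M prior)"
      by (simp only: split_beta')
  qed
  note this[OF B] this[OF sets.top]
  moreover have "(\<integral>\<^sup>+f. ennreal (likelihood n f x) * indicator (space prior) f \<partial>prior)
      = (\<integral>\<^sup>+f. ennreal (likelihood n f x) \<partial>prior)" for x
    by (intro nn_integral_cong) simp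
  ultimately show ?thesis
    unfolding posterior_def by (intro measurable_compose[OF borel_measurable_divide_ennreal]) simp_all
qed

lemma measurable_posterior:
  assumes B: "B \<in> sets prior"
  shows "(\<lambda>\<omega>. posterior prior n \<omega> B) \<in> borel_measurable true_path"
  using measurable_compose[OF measurable_restrict_sample measurable_posterior_sample[OF B]]
  by (simp only: posterior_restrict)

text \<open>
  The link between moments and prior averages.  By Fubini and the change of measure, the first moment
  of the integrated likelihood ratio on an event is the prior average of the probabilities of
  that event, restricted to samples at which \<open>f0\<close> is positive.
\<close>

lemma truncated_integral:
  assumes C: "C \<in> sets (sample_space M n)" and B: "B \<in> sets prior"
  shows "(\<integral>\<^sup>+\<omega>. indicator C (restrict \<omega> {..<n}) * integrated_ratio prior f0 n \<omega> B \<partial>true_path)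
    = (\<integral>\<^sup>+f\<in>B. ennreal (sample_prob M f n {x \<in> C. \<forall>i<n. 0 < f0 (x i)}) \<partial>prior)"
proof -
  have C': "(\<lambda>\<omega>. indicator C (restrict \<omega> {..<n}) :: ennreal) \<in> borel_measurable (path_measure M f)" for f
    by (rule measurable_compose[OF measurable_restrict_sample borel_measurable_indicator[OF C]])
  let ?h = "\<lambda>\<omega> f. indicator C (restrict \<omega> {..<n}) *
    (ennreal (likelihood_ratio f0 n f \<omega>) * indicator B f) :: ennreal"
  have h: "(\<lambda>(\<omega>, f). ?h \<omega> f) \<in> borel_measurable (true_path \<Otimes>\<^sub>M prior)"
    unfolding split_beta'
    by (intro borel_measurable_times_ennreal measurable_compose[OF measurable_path_ratio measurable_ennreal]
        measurable_compose[OF measurable_snd borel_measurable_indicator[OF B]]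
        measurable_compose[OF measurable_fst C'])
  have "(\<integral>\<^sup>+\<omega>. indicator C (restrict \<omega> {..<n}) * integrated_ratio prior f0 n \<omega> B \<partial>true_path)
      = (\<integral>\<^sup>+\<omega>. \<integral>\<^sup>+f. ?h \<omega> f \<partial>prior \<partial>true_path)"
    unfolding integrated_ratio_def
    by (intro nn_integral_cong nn_integral_cmult[symmetric] borel_measurable_times_ennreal
        borel_measurable_indicator[OF B] measurable_compose[OF measurable_prior_ratio measurable_ennreal])
  also have "\<dots> = (\<integral>\<^sup>+f. \<integral>\<^sup>+\<omega>. ?h \<omega> f \<partial>true_path \<partial>prior)"
    by (rule pair.Fubini'[OF h, symmetric])
  also have "\<dots> = (\<integral>\<^sup>+f\<in>B. ennreal (sample_prob M f n {x \<in> C. \<forall>i<n. 0 < f0 (x i)}) \<partial>prior)"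
  proof (rule nn_integral_cong)
    fix f assume f: "f \<in> space prior"
    interpret path: prob_space "path_measure M f" by (rule prob_space_path_measure[OF is_density[OF f]])
    let ?E = "{x \<in> C. \<forall>i<n. 0 < f0 (x i)}"
    have "?E = {x \<in> space (sample_space M n). \<forall>i<n. 0 < f0 (x i)} \<inter> C"
      using sets.sets_into_space[OF C] by auto
    also have "\<dots> \<in> sets (sample_space M n)"
      by (rule sets.Int[OF sets_all_pos[OF is_density_measurable[OF is_density_true]] C])
    finally have "(\<lambda>\<omega>. restrict \<omega> {..<n}) -` ?E \<inter> space (path_measure M f) \<in> sets (path_measure M f)"
      by (rule measurable_sets[OF measurable_restrict_sample])
    also have "(\<lambda>\<omega>. restrict \<omega> {..<n}) -` ?E \<inter> space (path_measure M f)
      = {\<omega> \<in> space (path_measure M f). restrict \<omega> {..<n} \<in> ?E}" by auto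
    finally have E: "{\<omega> \<in> space (path_measure M f). restrict \<omega> {..<n} \<in> ?E} \<in> sets (path_measure M f)" .
    have m: "(\<lambda>\<omega>. ennreal (likelihood_ratio f0 n f \<omega>)) \<in> borel_measurable true_path"
      using measurable_compose[OF measurable_restrict_sample measurable_likelihood_ratio[OF
            is_density_measurable[OF is_density_true] is_density_measurable[OF is_density[OF f]]]]
      by (simp only: likelihood_ratio_restrict)
    have "(\<integral>\<^sup>+\<omega>. ?h \<omega> f \<partial>true_path)
        = (\<integral>\<^sup>+\<omega>. indicator B f * (ennreal (likelihood_ratio f0 n f \<omega>) * indicator C (restrict \<omega> {..<n})) \<partial>true_path)"
      by (simp only: mult_ac)
    also have "\<dots> = indicator B f * (\<integral>\<^sup>+\<omega>. ennreal (likelihood_ratio f0 n f \<omega>) * indicator C (restrict \<omega> {..<n}) \<partial>true_path)"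
      by (rule nn_integral_cmult) (rule borel_measurable_times_ennreal[OF m C'])
    also have "(\<integral>\<^sup>+\<omega>. ennreal (likelihood_ratio f0 n f \<omega>) * indicator C (restrict \<omega> {..<n}) \<partial>true_path)
        = (\<integral>\<^sup>+\<omega>. indicator {\<omega>. \<forall>i<n. 0 < f0 (\<omega> i)} \<omega> * indicator C (restrict \<omega> {..<n}) \<partial>path_measure M f)"
      by (rule change_of_measure[OF sigma_finite is_density[OF f] is_density_true])
         (rule borel_measurable_indicator[OF C])
    also have "\<dots> = (\<integral>\<^sup>+\<omega>. indicator {\<omega> \<in> space (path_measure M f). restrict \<omega> {..<n} \<in> ?E} \<omega> \<partial>path_measure M f)"
      by (intro nn_integral_cong) (auto simp: indicator_def)
    also have "\<dots> = ennreal (sample_prob M f n ?E)"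
      unfolding sample_prob_def by (simp only: nn_integral_indicator[OF E] path.emeasure_eq_measure)
    finally show "(\<integral>\<^sup>+\<omega>. ?h \<omega> f \<partial>true_path) = ennreal (sample_prob M f n ?E) * indicator B f"
      by (simp only: mult.commute)
  qed
  finally show ?thesis .
qed

lemma integral_integrated_ratio_le_1:
  "(\<integral>\<^sup>+\<omega>. integrated_ratio prior f0 n \<omega> (space prior) \<partial>true_path) \<le> 1"
proof -
  have "(\<integral>\<^sup>+\<omega>. integrated_ratio prior f0 n \<omega> (space prior) \<partial>true_path)
      = (\<integral>\<^sup>+\<omega>. indicator (space (sample_space M n)) (restrict \<omega> {..<n}) *
            integrated_ratio prior f0 n \<omega> (space prior) \<partial>true_path)"
    by (intro nn_integral_cong) (simp add: restrict_in_sample_space)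
  also have "\<dots> = (\<integral>\<^sup>+f\<in>space prior. ennreal (sample_prob M f n
      {x \<in> space (sample_space M n). \<forall>i<n. 0 < f0 (x i)}) \<partial>prior)"
    by (rule truncated_integral) auto
  also have "\<dots> \<le> (\<integral>\<^sup>+f. 1 \<partial>prior)"
  proof (rule nn_integral_mono)
    fix f assume f: "f \<in> space prior"
    interpret path: prob_space "path_measure M f" by (rule prob_space_path_measure[OF is_density[OF f]])
    show "ennreal (sample_prob M f n {x \<in> space (sample_space M n). \<forall>i<n. 0 < f0 (x i)}) *
        indicator (space prior) f \<le> 1"
      using f unfolding sample_prob_def by simp
  qed
  also have "\<dots> = 1" by (simp add: prior.emeasure_space_1)
  finally show ?thesis .
qed

lemma integrated_ratio_mono: "integrated_ratio prior f0 n \<omega> B \<le> integrated_ratio prior f0 n \<omega> (space prior)"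
  unfolding integrated_ratio_def by (intro nn_integral_mono) (auto simp: indicator_def)

lemma AE_integrated_ratio_finite:
  "AE \<omega> in true_path. integrated_ratio prior f0 n \<omega> (space prior) \<noteq> \<infinity>"
proof (rule nn_integral_noteq_infinite)
  show "(\<integral>\<^sup>+\<omega>. integrated_ratio prior f0 n \<omega> (space prior) \<partial>true_path) \<noteq> \<infinity>"
    using integral_integrated_ratio_le_1[of n] by (auto simp: top_unique)
qed (rule measurable_integrated_ratio[OF sets.top])

lemma posterior_eq_ratio:
  assumes \<omega>: "\<omega> \<in> space true_path" and pos: "\<forall>i<n. 0 < f0 (\<omega> i)" and B: "B \<in> sets prior"
  shows "posterior prior n \<omega> B =
    enn2real (integrated_ratio prior f0 n \<omega> B / integrated_ratio prior f0 n \<omega> (space prior))"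
proof -
  let ?c = "likelihood n f0 \<omega>"
  have c: "0 < ?c" unfolding likelihood_def by (intro prod_pos) (use pos in auto)
  have eq: "ennreal (likelihood n f \<omega>) = ennreal ?c * ennreal (likelihood_ratio f0 n f \<omega>)" for f
  proof -
    have "likelihood n f \<omega> = ?c * likelihood_ratio f0 n f \<omega>"
      unfolding likelihood_def likelihood_ratio_def prod.distrib[symmetric]
      by (intro prod.cong refl) (use pos in auto)
    then show ?thesis using c by (simp add: ennreal_mult')
  qed
  have int: "(\<integral>\<^sup>+f\<in>C. ennreal (likelihood n f \<omega>) \<partial>prior) = ennreal ?c * integrated_ratio prior f0 n \<omega> C"
    if C: "C \<in> sets prior" for C
  proof -
    have "(\<integral>\<^sup>+f\<in>C. ennreal (likelihood n f \<omega>) \<partial>prior)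
        = (\<integral>\<^sup>+f. ennreal ?c * (ennreal (likelihood_ratio f0 n f \<omega>) * indicator C f) \<partial>prior)"
      by (rule nn_integral_cong, subst eq, rule mult.assoc)
    also have "\<dots> = ennreal ?c * integrated_ratio prior f0 n \<omega> C"
      unfolding integrated_ratio_def
      by (intro nn_integral_cmult borel_measurable_times_ennreal borel_measurable_indicator[OF C]
          measurable_compose[OF measurable_prior_ratio[OF \<omega>] measurable_ennreal])
    finally show ?thesis .
  qed
  have "(\<integral>\<^sup>+f. ennreal (likelihood n f \<omega>) \<partial>prior) = (\<integral>\<^sup>+f\<in>space prior. ennreal (likelihood n f \<omega>) \<partial>prior)"
    by (intro nn_integral_cong) simp
  also note int[OF sets.top]
  finally have total: "(\<integral>\<^sup>+f. ennreal (likelihood n f \<omega>) \<partial>prior)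
    = ennreal ?c * integrated_ratio prior f0 n \<omega> (space prior)" .
  show ?thesis
    unfolding posterior_def int[OF B] total ennreal_mult_divide_mult_cancel[OF c] ..
qed

text \<open>
  The definition of the posterior as a quotient, cleared of denominators.  In this form it also
  covers a vanishing denominator, and it can fail only where \<open>f0\<close> vanishes at an observation or
  the denominator is infinite, which has probability \<open>0\<close>.
\<close>

lemma AE_integrated_ratio_eq_posterior:
  assumes B: "B \<in> sets prior"
  shows "AE \<omega> in true_path. integrated_ratio prior f0 n \<omega> B =
    ennreal (posterior prior n \<omega> B) * integrated_ratio prior f0 n \<omega> (space prior)"
  using AE_path_pos[OF is_density_true, of n] AE_integrated_ratio_finite[of n] AE_space
proof eventually_elim
  case (elim \<omega>)
  let ?a = "integrated_ratio prior f0 n \<omega> B" and ?b = "integrated_ratio prior f0 n \<omega> (space prior)"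
  have ab: "?a \<le> ?b" by (rule integrated_ratio_mono)
  have p: "posterior prior n \<omega> B = enn2real (?a / ?b)"
    by (rule posterior_eq_ratio[OF elim(3,1) B])
  obtain r s where rs: "?a = ennreal r" "0 \<le> r" "?b = ennreal s" "0 \<le> s"
    using ab elim(2) by (cases ?a; cases ?b) (auto simp: top_unique)
  show ?case
  proof (cases "s = 0")
    case True
    then show ?thesis using ab rs by simp
  next
    case False
    then have "?a / ?b = ennreal (r / s)" using rs by (simp add: divide_ennreal)
    then show ?thesis using False rs unfolding p by (simp add: ennreal_mult[symmetric])
  qed
qed

section \<open>The denominator of the posterior\<close>

text \<open>
  By the weak law, the average of the \<open>n\<close> log-likelihood ratios \<open>ln (f0 / f)\<close> is close to the
  divergence of \<open>f\<close>, which is smaller than \<open>c\<close>.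
\<close>

lemma likelihood_ratio_lower_bound:
  assumes f: "is_density M f" and kl: "kl_div M f0 f < ereal c"
  shows "(\<lambda>n. measure true_path
    {\<omega> \<in> space true_path. likelihood_ratio f0 n f \<omega> \<le> exp (- real n * c)}) \<longlonglongrightarrow> 0"
proof -
  let ?N = "density M (\<lambda>x. ennreal (f0 x))"
  define y where "y x = ln (f0 x / f x)" for x
  note log_ratio = kl_div_log_ratio[OF f is_density_true kl]
  have y: "integrable ?N y" unfolding y_def by (rule log_ratio(2))
  define \<epsilon> where "\<epsilon> = c - (\<integral>x. y x \<partial>?N)"
  have \<epsilon>: "\<epsilon> > 0" using log_ratio(3) by (simp add: \<epsilon>_def y_def)
  let ?E = "\<lambda>n. {\<omega> \<in> space true_path. real n * \<epsilon> \<le> \<bar>(\<Sum>i<n. y (\<omega> i)) - real n * (\<integral>x. y x \<partial>?N)\<bar>}"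
  have wlln: "(\<lambda>n. measure true_path (?E n)) \<longlonglongrightarrow> 0"
    using weak_law_of_large_numbers[OF prob_space_density_of_density[OF is_density_true] y \<epsilon>]
    unfolding path_measure_def .
  have "measure true_path {\<omega> \<in> space true_path. likelihood_ratio f0 n f \<omega> \<le> exp (- real n * c)}
      \<le> measure true_path (?E n)" for n
  proof (rule true_path.finite_measure_mono_AE)
    have "AE \<omega> in true_path. \<forall>i\<in>{..<n}. 0 < f (\<omega> i)"
      by (intro eventually_ball_finite ballI AE_path_coordinate[OF is_density_true] log_ratio(1)) auto
    with AE_path_pos[OF is_density_true, of n]
    show "AE \<omega> in true_path. \<omega> \<in> {\<omega> \<in> space true_path. likelihood_ratio f0 n f \<omega> \<le> exp (- real n * c)}
        \<longrightarrow> \<omega> \<in> ?E n"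
    proof eventually_elim
      case (elim \<omega>)
      have "likelihood_ratio f0 n f \<omega> = (\<Prod>i<n. exp (- y (\<omega> i)))"
        unfolding likelihood_ratio_def
      proof (rule prod.cong[OF refl])
        fix i assume "i \<in> {..<n}"
        with elim have "0 < f0 (\<omega> i)" "0 < f (\<omega> i)" by auto
        then show "f (\<omega> i) / f0 (\<omega> i) = exp (- y (\<omega> i))"
          by (simp add: y_def exp_minus)
      qed
      also have "\<dots> = exp (- (\<Sum>i<n. y (\<omega> i)))"
        by (simp add: exp_sum[symmetric] sum_negf)
      finally have "likelihood_ratio f0 n f \<omega> \<le> exp (- real n * c) \<longleftrightarrow> real n * c \<le> (\<Sum>i<n. y (\<omega> i))"
        by simp
      moreover have "real n * \<epsilon> = real n * c - real n * (\<integral>x. y x \<partial>?N)"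
        by (simp add: \<epsilon>_def right_diff_distrib)
      ultimately show ?case by auto
    qed
    have ym: "y \<in> borel_measurable M" using borel_measurable_integrable[OF y] by simp
    have "(\<lambda>\<omega>. y (\<omega> i)) \<in> borel_measurable true_path" for i
      by (rule measurable_compose[OF _ ym])
         (subst measurable_cong_sets[OF sets_path_measure refl], simp)
    then have "(\<lambda>\<omega>. \<bar>(\<Sum>i<n. y (\<omega> i)) - real n * (\<integral>x. y x \<partial>?N)\<bar>) \<in> borel_measurable true_path"
      by (intro borel_measurable_abs borel_measurable_diff borel_measurable_sum borel_measurable_const)
    then show "?E n \<in> true_path.events"
      by (rule borel_measurable_le[OF borel_measurable_const])
  qed
  then show ?thesis
    by (intro tendsto_sandwich[OF _ _ tendsto_const wlln] always_eventually allI measure_nonneg)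
qed

text \<open>
  What the Kullback-Leibler support provides: the denominator of the posterior decays more slowly
  than any exponential.  Let \<open>B\<close> be the ball of divergence \<open>c / 2\<close> and
  \<open>t n = exp (- n c / 2)\<close>.  For each single \<open>f\<close> in \<open>B\<close> the likelihood ratio exceeds \<open>t n\<close> with
  probability tending to \<open>1\<close>.  By dominated convergence and Fubini, the expected prior mass
  \<open>G n\<close> of the part of \<open>B\<close> where this fails tends to \<open>0\<close>, so by Markov's inequality it is below
  half of the mass of \<open>B\<close> with high probability.  The remaining half contributes at least
  \<open>t n\<close> times a constant to the denominator.
\<close>

lemma integrated_ratio_lower_bound:
  assumes kl: "in_kl_support M prior f0" and c: "c > 0"
  shows "(\<lambda>n. measure true_path
    {\<omega> \<in> space true_path. integrated_ratio prior f0 n \<omega> (space prior) < ennreal (exp (- real n * c))})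
    \<longlonglongrightarrow> 0"
proof -
  define B where "B = {f \<in> space prior. kl_div M f0 f < ereal (c / 2)}"
  define b where "b = measure prior B"
  have b: "b > 0" using kl c unfolding in_kl_support_def b_def B_def by simp
  have B: "B \<in> sets prior"
    using b measure_notin_sets[of B prior] unfolding b_def by (cases "B \<in> sets prior") auto
  have eb: "emeasure prior B = ennreal b" unfolding b_def by (rule prior.emeasure_eq_measure)
  define t where "t n = exp (- real n * (c / 2))" for n
  have t: "t n > 0" "t n * t n = exp (- real n * c)" for n
    by (simp_all add: t_def mult_exp_exp)
  let ?small = "\<lambda>n \<omega> f. indicator {p. likelihood_ratio f0 n (snd p) (fst p) \<le> t n} (\<omega>, f) * indicator B f :: ennreal"
  have small: "(\<lambda>p. ?small n (fst p) (snd p)) \<in> borel_measurable (true_path \<Otimes>\<^sub>M prior)" for n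
  proof -
    have "{p \<in> space (true_path \<Otimes>\<^sub>M prior). likelihood_ratio f0 n (snd p) (fst p) \<le> t n}
        \<in> sets (true_path \<Otimes>\<^sub>M prior)"
      by (rule borel_measurable_le[OF measurable_path_ratio borel_measurable_const])
    then have "(indicator {p. likelihood_ratio f0 n (snd p) (fst p) \<le> t n} :: _ \<Rightarrow> ennreal)
        \<in> borel_measurable (true_path \<Otimes>\<^sub>M prior)"
      by (subst borel_measurable_indicator_iff) (simp only: Collect_conj_eq Int_commute Collect_mem_eq)
    then show ?thesis
      by (intro borel_measurable_times_ennreal
          measurable_compose[OF measurable_snd borel_measurable_indicator[OF B]]) simp
  qed
  then have small': "(\<lambda>(\<omega>, f). ?small n \<omega> f) \<in> borel_measurable (true_path \<Otimes>\<^sub>M prior)" for n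
    by (simp only: split_beta')
  define G where "G n \<omega> = (\<integral>\<^sup>+f. ?small n \<omega> f \<partial>prior)" for n \<omega>
  have Gm: "G n \<in> borel_measurable true_path" for n
    unfolding G_def by (rule prior.borel_measurable_nn_integral[OF small'])
  define V where "V n f = (\<integral>\<^sup>+\<omega>. ?small n \<omega> f \<partial>true_path)" for n f
  have Vm: "V n \<in> borel_measurable prior" for n
  proof -
    have "(\<lambda>(f, \<omega>). ?small n \<omega> f) \<in> borel_measurable (prior \<Otimes>\<^sub>M true_path)"
      using measurable_compose[OF measurable_pair_swap' small'[of n]] by (simp add: split_beta')
    then show ?thesis unfolding V_def by (rule true_path.borel_measurable_nn_integral)
  qed
  have "(\<lambda>n. V n f) \<longlonglongrightarrow> 0" if f: "f \<in> space prior" for f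
  proof (cases "f \<in> B")
    case True
    then have kl_f: "kl_div M f0 f < ereal (c / 2)" by (simp add: B_def)
    have m: "(\<lambda>\<omega>. likelihood_ratio f0 n f \<omega>) \<in> borel_measurable true_path" for n
      using measurable_compose[OF measurable_Pair2'[OF f] measurable_path_ratio] by simp
    have "V n f = ennreal (measure true_path {\<omega> \<in> space true_path. likelihood_ratio f0 n f \<omega> \<le> t n})" for n
    proof -
      have "V n f = (\<integral>\<^sup>+\<omega>. indicator {\<omega> \<in> space true_path. likelihood_ratio f0 n f \<omega> \<le> t n} \<omega> \<partial>true_path)"
        unfolding V_def using True by (intro nn_integral_cong) (simp add: indicator_def)
      then show ?thesis
        by (simp only: true_path.emeasure_eq_measure
            nn_integral_indicator[OF borel_measurable_le[OF m borel_measurable_const]])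
    qed
    moreover have "(\<lambda>n. ennreal (measure true_path {\<omega> \<in> space true_path. likelihood_ratio f0 n f \<omega> \<le> t n}))
        \<longlonglongrightarrow> ennreal 0"
      using likelihood_ratio_lower_bound[OF is_density[OF f] kl_f] unfolding t_def by (rule tendsto_ennrealI)
    ultimately show ?thesis by simp
  qed (simp add: V_def)
  then have "(\<lambda>n. \<integral>\<^sup>+f. V n f \<partial>prior) \<longlonglongrightarrow> (\<integral>\<^sup>+f. 0 \<partial>prior)"
  proof (intro nn_integral_dominated_convergence[where w = "\<lambda>_. 1"] Vm AE_I2)
    fix n f
    have "V n f \<le> (\<integral>\<^sup>+\<omega>. 1 \<partial>true_path)"
      unfolding V_def by (intro nn_integral_mono) (auto simp: indicator_def)
    then show "V n f \<le> 1" by (simp add: true_path.emeasure_space_1)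
  qed (auto simp: prior.emeasure_space_1)
  moreover have "(\<integral>\<^sup>+f. V n f \<partial>prior) = (\<integral>\<^sup>+\<omega>. G n \<omega> \<partial>true_path)" for n
    unfolding V_def G_def by (rule pair.Fubini'[OF small'])
  ultimately have "(\<lambda>n. \<integral>\<^sup>+\<omega>. G n \<omega> \<partial>true_path) \<longlonglongrightarrow> 0" by simp
  then have lim: "(\<lambda>n. ennreal (2 / b) * (\<integral>\<^sup>+\<omega>. G n \<omega> \<partial>true_path)) \<longlonglongrightarrow> 0"
    using ennreal_tendsto_cmult[of "ennreal (2 / b)" "\<lambda>n. \<integral>\<^sup>+\<omega>. G n \<omega> \<partial>true_path" 0 sequentially] by simp
  \<comment> \<open>At each \<open>f\<close> in \<open>B\<close>, either the likelihood ratio is small, or it is itself at least \<open>t n\<close>.\<close>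
  have split: "ennreal (t n * b) \<le> ennreal (t n) * G n \<omega> + integrated_ratio prior f0 n \<omega> (space prior)"
    if \<omega>: "\<omega> \<in> space true_path" for n \<omega>
  proof -
    have Gm': "?small n \<omega> \<in> borel_measurable prior"
      using measurable_compose[OF measurable_Pair1'[OF \<omega>] small] by simp
    have rm: "(\<lambda>f. ennreal (likelihood_ratio f0 n f \<omega>) * indicator (space prior) f) \<in> borel_measurable prior"
      by (intro borel_measurable_times_ennreal borel_measurable_indicator[OF sets.top]
          measurable_compose[OF measurable_prior_ratio[OF \<omega>] measurable_ennreal])
    have "ennreal (t n * b) = (\<integral>\<^sup>+f. ennreal (t n) * indicator B f \<partial>prior)"
      using B t(1)[of n] by (simp add: nn_integral_cmult_indicator eb ennreal_mult')
    also have "\<dots> \<le> (\<integral>\<^sup>+f. ennreal (t n) * ?small n \<omega> f +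
        ennreal (likelihood_ratio f0 n f \<omega>) * indicator (space prior) f \<partial>prior)"
    proof (rule nn_integral_mono)
      fix f assume f: "f \<in> space prior"
      show "ennreal (t n) * indicator B f \<le> ennreal (t n) * ?small n \<omega> f +
        ennreal (likelihood_ratio f0 n f \<omega>) * indicator (space prior) f"
        using f by (cases "likelihood_ratio f0 n f \<omega> \<le> t n") (auto simp: indicator_def intro!: ennreal_leI)
    qed
    also have "\<dots> = ennreal (t n) * G n \<omega> + integrated_ratio prior f0 n \<omega> (space prior)"
      unfolding G_def integrated_ratio_def
      by (subst nn_integral_add[OF _ rm])
         (intro borel_measurable_times_ennreal borel_measurable_const Gm',
          simp only: nn_integral_cmult[OF Gm'])
    finally show ?thesis .
  qed
  let ?E = "\<lambda>n. {\<omega> \<in> space true_path.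
      integrated_ratio prior f0 n \<omega> (space prior) < ennreal (exp (- real n * c))}"
  have "(\<lambda>n. t n) \<longlonglongrightarrow> 0"
  proof -
    have "t n = exp (- c / 2) ^ n" for n
      by (simp add: t_def exp_of_nat_mult[symmetric])
    moreover have "(\<lambda>n. exp (- c / 2) ^ n) \<longlonglongrightarrow> 0" using c by (intro LIMSEQ_power_zero) simp
    ultimately show ?thesis by simp
  qed
  then have "eventually (\<lambda>n. t n < b / 2) sequentially"
    using order_tendstoD(2)[of t 0 sequentially "b / 2"] b by simp
  then have bound: "eventually (\<lambda>n. emeasure true_path (?E n) \<le> ennreal (2 / b) * (\<integral>\<^sup>+\<omega>. G n \<omega> \<partial>true_path)) sequentially"
  proof eventually_elim
    case (elim n)
    have "?E n \<subseteq> {\<omega> \<in> space true_path. 1 \<le> ennreal (2 / b) * G n \<omega>}"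
    proof safe
      fix \<omega> assume \<omega>: "\<omega> \<in> space true_path"
        and less: "integrated_ratio prior f0 n \<omega> (space prior) < ennreal (exp (- real n * c))"
      show "1 \<le> ennreal (2 / b) * G n \<omega>"
      proof (cases "G n \<omega>")
        case (real g)
        have "integrated_ratio prior f0 n \<omega> (space prior) \<le> ennreal (t n * (b / 2))"
        proof -
          \<comment> \<open>One factor \<open>t n\<close> of \<open>exp (- n c) = t n * t n\<close> absorbs the constant \<open>b / 2\<close>.\<close>
          have "exp (- real n * c) \<le> t n * (b / 2)"
            unfolding t(2)[symmetric] using elim t(1)[of n] by (intro mult_left_mono) auto
          with less show ?thesis by (meson ennreal_leI less_imp_le order_trans)
        qed
        then have "ennreal (t n * b) \<le> ennreal (t n) * ennreal g + ennreal (t n * (b / 2))"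
          using split[OF \<omega>, of n] unfolding real by (meson add_left_mono order_trans)
        also have "\<dots> = ennreal (t n * g + t n * (b / 2))"
          using real t(1)[of n] b by (simp add: ennreal_mult[symmetric])
        finally have "t n * b \<le> t n * g + t n * (b / 2)"
          using real t(1)[of n] b by (subst (asm) ennreal_le_iff) auto
        then have "t n * (b / 2) \<le> t n * g" by (simp add: field_simps)
        then have "b / 2 \<le> g" using t(1)[of n] by simp
        then have "1 \<le> 2 / b * g" using b by (simp add: field_simps)
        then have "ennreal 1 \<le> ennreal (2 / b * g)" by (rule ennreal_leI)
        also have "\<dots> = ennreal (2 / b) * G n \<omega>"
          unfolding real by (rule ennreal_mult) (use real b in auto)
        finally show ?thesis by simp
      qed (use b in \<open>simp add: ennreal_mult_top\<close>)
    qed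
    then have "emeasure true_path (?E n) \<le> emeasure true_path {\<omega> \<in> space true_path. 1 \<le> ennreal (2 / b) * G n \<omega>}"
      by (intro emeasure_mono borel_measurable_le borel_measurable_const borel_measurable_times_ennreal Gm)
    also have "\<dots> \<le> ennreal (2 / b) * (\<integral>\<^sup>+\<omega>. G n \<omega> * indicator (space true_path) \<omega> \<partial>true_path)"
      by (intro nn_integral_Markov_inequality borel_measurable_times_ennreal Gm borel_measurable_indicator sets.top)
    also have "(\<integral>\<^sup>+\<omega>. G n \<omega> * indicator (space true_path) \<omega> \<partial>true_path) = (\<integral>\<^sup>+\<omega>. G n \<omega> \<partial>true_path)"
      by (intro nn_integral_cong) simp
    finally show ?case .
  qed
  have "(\<lambda>n. emeasure true_path (?E n)) \<longlonglongrightarrow> ennreal 0"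
    using tendsto_sandwich[OF _ bound tendsto_const lim] by simp
  then show ?thesis unfolding measure_def by (rule tendsto_enn2real) simp
qed

section \<open>The implications\<close>

lemma sets_path_event:
  "C \<in> sets (sample_space M n) \<Longrightarrow>
    {\<omega> \<in> space (path_measure M f). restrict \<omega> {..<n} \<in> C} \<in> sets (path_measure M f)"
  using measurable_sets[OF measurable_restrict_sample, of C M n f]
  by (simp add: vimage_def Int_def conj_commute)

lemma measurable_indicator_sample:
  "C \<in> sets (sample_space M n) \<Longrightarrow>
    (\<lambda>\<omega>. indicator C (restrict \<omega> {..<n}) :: ennreal) \<in> borel_measurable true_path"
  by (rule measurable_compose[OF measurable_restrict_sample borel_measurable_indicator])

lemma truncated_moment_one:
  "truncated_moment M prior f0 n B D 1 = (\<integral>\<^sup>+\<omega>. indicator (space (sample_space M n) - D)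
    (restrict \<omega> {..<n}) * integrated_ratio prior f0 n \<omega> B \<partial>true_path)"
  by (simp add: truncated_moment_def)

text \<open>
  One half of the rate is given up to absorb an arbitrary \<open>\<epsilon>\<close> into the exponential.
\<close>

lemma posterior_decay_iff_tendsto_in_prob:
  assumes A: "\<And>n. n \<ge> 1 \<Longrightarrow> A n \<in> sets prior"
  shows "(\<exists>\<beta>>0. tendsto_in_prob true_path (\<lambda>n \<omega>. exp (real n * \<beta>) * posterior prior n \<omega> (A n)) 0)
    \<longleftrightarrow> (\<exists>\<beta>>0. (\<lambda>n. measure true_path
          {\<omega> \<in> space true_path. posterior prior n \<omega> (A n) > exp (- real n * \<beta>)}) \<longlonglongrightarrow> 0)"
    (is "?i \<longleftrightarrow> ?ii")
proof
  have exceeds: "1 < exp (real n * \<beta>) * p \<longleftrightarrow> exp (- real n * \<beta>) < p" for n \<beta> and p :: real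
    by (simp add: exp_minus field_simps)
  assume ?i
  then obtain \<beta> where \<beta>: "\<beta> > 0"
    "tendsto_in_prob true_path (\<lambda>n \<omega>. exp (real n * \<beta>) * posterior prior n \<omega> (A n)) 0" by blast
  have "posterior prior n \<omega> B \<ge> 0" for n \<omega> B by (simp add: posterior_def)
  then have "\<bar>exp (real n * \<beta>) * posterior prior n \<omega> (A n) - 0\<bar> > 1
      \<longleftrightarrow> posterior prior n \<omega> (A n) > exp (- real n * \<beta>)" for n \<omega>
    by (simp only: diff_0_right abs_mult abs_exp_cancel abs_of_nonneg exceeds)
  with \<beta>(2)[unfolded tendsto_in_prob_def, rule_format, of 1] \<beta>(1) show ?ii by auto
next
  assume ?ii
  then obtain \<beta> where \<beta>: "\<beta> > 0" and lim: "(\<lambda>n. measure true_path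
      {\<omega> \<in> space true_path. posterior prior n \<omega> (A n) > exp (- real n * \<beta>)}) \<longlonglongrightarrow> 0" by blast
  have "tendsto_in_prob true_path (\<lambda>n \<omega>. exp (real n * (\<beta> / 2)) * posterior prior n \<omega> (A n)) 0"
    unfolding tendsto_in_prob_def
  proof (intro allI impI)
    fix \<epsilon> :: real assume \<epsilon>: "\<epsilon> > 0"
    have "(\<lambda>n. exp (- \<beta> / 2) ^ n) \<longlonglongrightarrow> 0" using \<beta> by (intro LIMSEQ_power_zero) simp
    then have "eventually (\<lambda>n. exp (- \<beta> / 2) ^ n < \<epsilon>) sequentially"
      using order_tendstoD(2)[of _ 0] \<epsilon> by blast
    then have "eventually (\<lambda>n. measure true_path
        {\<omega> \<in> space true_path. \<bar>exp (real n * (\<beta> / 2)) * posterior prior n \<omega> (A n) - 0\<bar> > \<epsilon>}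
        \<le> measure true_path {\<omega> \<in> space true_path. posterior prior n \<omega> (A n) > exp (- real n * \<beta>)}) sequentially"
      using eventually_ge_at_top[of 1]
    proof eventually_elim
      case (elim n)
      show ?case
      proof (rule true_path.finite_measure_mono)
        show "{\<omega> \<in> space true_path. \<bar>exp (real n * (\<beta> / 2)) * posterior prior n \<omega> (A n) - 0\<bar> > \<epsilon>}
          \<subseteq> {\<omega> \<in> space true_path. posterior prior n \<omega> (A n) > exp (- real n * \<beta>)}"
        proof safe
          fix \<omega> assume "\<epsilon> < \<bar>exp (real n * (\<beta> / 2)) * posterior prior n \<omega> (A n) - 0\<bar>"
          then have "exp (- \<beta> / 2) ^ n < exp (real n * (\<beta> / 2)) * posterior prior n \<omega> (A n)"
            using elim(1) by (simp add: posterior_def abs_mult)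
          then have "exp (- real n * (\<beta> / 2)) * exp (- \<beta> / 2) ^ n
              < exp (- real n * (\<beta> / 2)) * (exp (real n * (\<beta> / 2)) * posterior prior n \<omega> (A n))"
            by (intro mult_strict_left_mono) auto
          then show "exp (- real n * \<beta>) < posterior prior n \<omega> (A n)"
            by (simp add: exp_of_nat_mult[symmetric] mult_exp_exp mult.assoc[symmetric] mult.commute[of \<beta>])
        qed
        show "{\<omega> \<in> space true_path. posterior prior n \<omega> (A n) > exp (- real n * \<beta>)} \<in> true_path.events"
          by (rule borel_measurable_less[OF borel_measurable_const measurable_posterior[OF A[OF elim(2)]]])
      qed
    qed
    then show "(\<lambda>n. measure true_path
        {\<omega> \<in> space true_path. \<bar>exp (real n * (\<beta> / 2)) * posterior prior n \<omega> (A n) - 0\<bar> > \<epsilon>}) \<longlonglongrightarrow> 0"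
      by (rule tendsto_sandwich[OF always_eventually[OF allI[OF measure_nonneg]] _ tendsto_const lim])
  qed
  with \<beta> show ?i by (intro exI[of _ "\<beta> / 2"]) simp
qed

text \<open>
  Discard the samples at which the posterior mass is not exponentially small.  On the others the
  integrated likelihood ratio over \<open>A n\<close> is the posterior mass times the total integrated ratio,
  whose expectation is at most \<open>1\<close>; hence every fractional moment is exponentially small.
\<close>

lemma moment_bound_of_posterior_decay:
  assumes A: "\<And>n. n \<ge> 1 \<Longrightarrow> A n \<in> sets prior" and \<beta>: "\<beta> > 0" and \<alpha>: "0 < \<alpha>" "\<alpha> \<le> 1"
    and lim: "(\<lambda>n. measure true_path
        {\<omega> \<in> space true_path. posterior prior n \<omega> (A n) > exp (- real n * \<beta>)}) \<longlonglongrightarrow> 0"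
  shows "\<exists>\<gamma> D. \<gamma> > 0 \<and> vanishing_sets M f0 D \<and> (\<forall>\<^sub>F n in sequentially.
    truncated_moment M prior f0 n (A n) (D n) \<alpha> \<le> ennreal (exp (- real n * \<gamma>)))"
proof (intro exI conjI)
  let ?D = "\<lambda>n. {x \<in> space (sample_space M n). posterior prior n x (A n) > exp (- real n * \<beta>)}"
  have "sample_prob M f0 n (?D n)
      = measure true_path {\<omega> \<in> space true_path. posterior prior n \<omega> (A n) > exp (- real n * \<beta>)}" for n
    unfolding sample_prob_def
    by (intro arg_cong[where f = "measure true_path"] Collect_cong)
       (auto simp: posterior_restrict restrict_in_sample_space)
  then show "vanishing_sets M f0 ?D"
    unfolding vanishing_sets_def using lim
    by (auto intro!: borel_measurable_less[OF borel_measurable_const measurable_posterior_sample[OF A]])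
  show "\<alpha> * \<beta> / 2 > 0" using \<alpha> \<beta> by simp
  have bound: "truncated_moment M prior f0 n (A n) (?D n) \<alpha> \<le> ennreal (2 * exp (- real n * (\<alpha> * \<beta>)))"
    if n: "n \<ge> 1" for n
  proof -
    let ?I = "\<lambda>\<omega>. integrated_ratio prior f0 n \<omega> (space prior)"
    have Im: "?I \<in> borel_measurable true_path" by (rule measurable_integrated_ratio[OF sets.top])
    have "truncated_moment M prior f0 n (A n) (?D n) \<alpha>
        \<le> (\<integral>\<^sup>+\<omega>. ennreal (exp (- real n * (\<alpha> * \<beta>))) * (1 + ?I \<omega>) \<partial>true_path)"
      unfolding truncated_moment_def
    proof (rule nn_integral_mono_AE)
      show "AE \<omega> in true_path. ennreal_powr (indicator (space (sample_space M n) - ?D n) (restrict \<omega> {..<n}) *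
          integrated_ratio prior f0 n \<omega> (A n)) \<alpha> \<le> ennreal (exp (- real n * (\<alpha> * \<beta>))) * (1 + ?I \<omega>)"
        using AE_integrated_ratio_eq_posterior[OF A[OF n], of n] AE_space
      proof eventually_elim
        case (elim \<omega>)
        have "indicator (space (sample_space M n) - ?D n) (restrict \<omega> {..<n}) *
            integrated_ratio prior f0 n \<omega> (A n) \<le> ennreal (exp (- real n * \<beta>)) * ?I \<omega>"
        proof (cases "posterior prior n \<omega> (A n) > exp (- real n * \<beta>)")
          case True
          then have "restrict \<omega> {..<n} \<notin> space (sample_space M n) - ?D n"
            by (auto simp: posterior_restrict)
          then show ?thesis by simp
        next
          case False
          then have "integrated_ratio prior f0 n \<omega> (A n) \<le> ennreal (exp (- real n * \<beta>)) * ?I \<omega>"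
            unfolding elim(1) by (intro mult_right_mono ennreal_leI) auto
          then show ?thesis by (auto simp: indicator_def)
        qed
        then have "ennreal_powr (indicator (space (sample_space M n) - ?D n) (restrict \<omega> {..<n}) *
            integrated_ratio prior f0 n \<omega> (A n)) \<alpha> \<le> ennreal_powr (ennreal (exp (- real n * \<beta>)) * ?I \<omega>) \<alpha>"
          using \<alpha>(1) by (rule ennreal_powr_mono)
        also have "\<dots> = ennreal (exp (- real n * \<beta>) powr \<alpha>) * ennreal_powr (?I \<omega>) \<alpha>"
          by (rule ennreal_powr_mult_const) simp
        also have "exp (- real n * \<beta>) powr \<alpha> = exp (- real n * (\<alpha> * \<beta>))"
          by (simp add: powr_def mult_ac)
        also have "ennreal (exp (- real n * (\<alpha> * \<beta>))) * ennreal_powr (?I \<omega>) \<alpha>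
            \<le> ennreal (exp (- real n * (\<alpha> * \<beta>))) * (1 + ?I \<omega>)"
          by (intro mult_left_mono ennreal_powr_le_one_plus \<alpha>) simp
        finally show ?case .
      qed
    qed
    also have "\<dots> = ennreal (exp (- real n * (\<alpha> * \<beta>))) * (1 + (\<integral>\<^sup>+\<omega>. ?I \<omega> \<partial>true_path))"
      by (subst nn_integral_cmult, intro borel_measurable_add borel_measurable_const Im)
         (simp add: nn_integral_add[OF borel_measurable_const Im] true_path.emeasure_space_1)
    also have "\<dots> \<le> ennreal (exp (- real n * (\<alpha> * \<beta>))) * (1 + 1)"
      by (intro mult_left_mono add_left_mono integral_integrated_ratio_le_1) simp
    also have "\<dots> = ennreal (2 * exp (- real n * (\<alpha> * \<beta>)))"
      by (subst mult.commute, subst ennreal_mult) auto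
    finally show ?thesis .
  qed
  have "(\<lambda>n. exp (- (\<alpha> * \<beta> / 2)) ^ n) \<longlonglongrightarrow> 0" using \<alpha> \<beta> by (intro LIMSEQ_power_zero) simp
  then have "eventually (\<lambda>n. exp (- (\<alpha> * \<beta> / 2)) ^ n < 1 / 2) sequentially"
    by (rule order_tendstoD) simp
  then show "\<forall>\<^sub>F n in sequentially. truncated_moment M prior f0 n (A n) (?D n) \<alpha>
      \<le> ennreal (exp (- real n * (\<alpha> * \<beta> / 2)))"
    using eventually_ge_at_top[of 1]
  proof eventually_elim
    case (elim n)
    let ?e = "exp (- real n * (\<alpha> * \<beta> / 2))"
    have e: "exp (- (\<alpha> * \<beta> / 2)) ^ n = ?e" by (simp add: exp_of_nat_mult[symmetric])
    have "2 * exp (- real n * (\<alpha> * \<beta>)) = 2 * (?e * ?e)" by (simp add: mult_exp_exp)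
    also have "\<dots> \<le> 1 * ?e" using elim(1) unfolding e mult.assoc[symmetric]
      by (intro mult_right_mono) auto
    finally have "2 * exp (- real n * (\<alpha> * \<beta>)) \<le> ?e" by simp
    with bound[OF elim(2)] show ?case by (meson ennreal_leI order_trans)
  qed
qed

text \<open>
  By Markov's inequality the numerator of the posterior is exponentially small outside \<open>D n\<close>, and
  the denominator is not too small because of \<open>integrated_ratio_lower_bound\<close>.
\<close>

lemma posterior_decay_of_moment_bound:
  assumes kl: "in_kl_support M prior f0" and A: "\<And>n. n \<ge> 1 \<Longrightarrow> A n \<in> sets prior"
    and \<alpha>: "0 < \<alpha>" and \<beta>: "\<beta> > 0" and D: "vanishing_sets M f0 D"
    and bound: "\<forall>\<^sub>F n in sequentially.
      truncated_moment M prior f0 n (A n) (D n) \<alpha> \<le> ennreal (exp (- real n * \<beta>))"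
  shows "\<exists>\<gamma>>0. (\<lambda>n. measure true_path
    {\<omega> \<in> space true_path. posterior prior n \<omega> (A n) > exp (- real n * \<gamma>)}) \<longlonglongrightarrow> 0"
proof (intro exI conjI)
  \<comment> \<open>Outside \<open>D n\<close>, if the denominator is at least \<open>exp (- n c)\<close> and the posterior exceeds \<open>exp (- n c)\<close>, then the numerator
      to the power \<open>\<alpha>\<close> is at least \<open>exp (- 2 n c \<alpha>) = exp (- n \<beta> / 2)\<close>, an event that Markov's inequality makes improbable.\<close>
  define c where "c = \<beta> / (4 * \<alpha>)"
  show c: "c > 0" using \<alpha> \<beta> by (simp add: c_def)
  let ?I = "\<lambda>n \<omega> B. integrated_ratio prior f0 n \<omega> B"
  let ?T = "\<lambda>n \<omega>. ennreal_powr (indicator (space (sample_space M n) - D n) (restrict \<omega> {..<n}) * ?I n \<omega> (A n)) \<alpha>"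
  let ?E1 = "\<lambda>n. {\<omega> \<in> space true_path. restrict \<omega> {..<n} \<in> D n}"
  let ?E2 = "\<lambda>n. {\<omega> \<in> space true_path. ?I n \<omega> (space prior) < ennreal (exp (- real n * c))}"
  let ?E3 = "\<lambda>n. {\<omega> \<in> space true_path. 1 \<le> ennreal (exp (real n * (\<beta> / 2))) * ?T n \<omega>}"
  let ?E = "\<lambda>n. {\<omega> \<in> space true_path. posterior prior n \<omega> (A n) > exp (- real n * c)}"
  have E2: "?E2 n \<in> true_path.events" for n
    by (intro borel_measurable_less borel_measurable_const measurable_integrated_ratio sets.top)
  have E3: "eventually (\<lambda>n. measure true_path (?E3 n) \<le> exp (- \<beta> / 2) ^ n \<and> ?E3 n \<in> true_path.events) sequentially"
    using bound eventually_ge_at_top[of 1]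
  proof eventually_elim
    case (elim n)
    have Dn: "D n \<in> sets (sample_space M n)" using D elim(2) by (simp add: vanishing_sets_def)
    have Tm: "?T n \<in> borel_measurable true_path"
      by (intro measurable_ennreal_powr borel_measurable_times_ennreal measurable_indicator_sample
          measurable_integrated_ratio A elim(2) sets.compl_sets Dn)
    have "emeasure true_path (?E3 n) \<le> ennreal (exp (real n * (\<beta> / 2))) *
        (\<integral>\<^sup>+\<omega>. ?T n \<omega> * indicator (space true_path) \<omega> \<partial>true_path)"
      by (intro nn_integral_Markov_inequality borel_measurable_times_ennreal Tm borel_measurable_indicator sets.top)
    also have "(\<integral>\<^sup>+\<omega>. ?T n \<omega> * indicator (space true_path) \<omega> \<partial>true_path)
        = truncated_moment M prior f0 n (A n) (D n) \<alpha>"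
      unfolding truncated_moment_def by (intro nn_integral_cong) simp
    also have "ennreal (exp (real n * (\<beta> / 2))) * \<dots> \<le> ennreal (exp (real n * (\<beta> / 2))) * ennreal (exp (- real n * \<beta>))"
      by (intro mult_left_mono elim(1)) simp
    also have "\<dots> = ennreal (exp (- \<beta> / 2) ^ n)"
      by (simp add: ennreal_mult[symmetric] mult_exp_exp exp_of_nat_mult[symmetric] algebra_simps)
    finally have "measure true_path (?E3 n) \<le> exp (- \<beta> / 2) ^ n"
      by (simp only: true_path.emeasure_eq_measure) (subst (asm) ennreal_le_iff, auto)
    moreover have "?E3 n \<in> true_path.events"
      by (intro borel_measurable_le borel_measurable_const borel_measurable_times_ennreal Tm)
    ultimately show ?case by simp
  qed
  have "eventually (\<lambda>n. measure true_path (?E n)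
      \<le> sample_prob M f0 n (D n) + measure true_path (?E2 n) + exp (- \<beta> / 2) ^ n) sequentially"
    using E3 eventually_ge_at_top[of 1]
  proof eventually_elim
    case (elim n)
    have Dn: "D n \<in> sets (sample_space M n)" using D elim(2) by (simp add: vanishing_sets_def)
    have E1: "?E1 n \<in> true_path.events" by (rule sets_path_event[OF Dn])
    have "measure true_path (?E n) \<le> measure true_path (?E1 n \<union> ?E2 n \<union> ?E3 n)"
    proof (rule true_path.finite_measure_mono_AE)
      show "AE \<omega> in true_path. \<omega> \<in> ?E n \<longrightarrow> \<omega> \<in> ?E1 n \<union> ?E2 n \<union> ?E3 n"
        using AE_integrated_ratio_eq_posterior[OF A[OF elim(2)], of n]
      proof eventually_elim
        case (elim \<omega>)
        show ?case
        proof (intro impI, rule ccontr)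
          assume E: "\<omega> \<in> ?E n" and "\<omega> \<notin> ?E1 n \<union> ?E2 n \<union> ?E3 n"
          then have \<omega>: "\<omega> \<in> space true_path" "restrict \<omega> {..<n} \<notin> D n"
            "ennreal (exp (- real n * c)) \<le> ?I n \<omega> (space prior)"
            and T: "\<not> 1 \<le> ennreal (exp (real n * (\<beta> / 2))) * ?T n \<omega>"
            by (auto simp: not_less)
          have "ennreal (exp (- real n * (2 * c))) = ennreal (exp (- real n * c)) * ennreal (exp (- real n * c))"
            by (simp add: ennreal_mult[symmetric] mult_exp_exp)
          also have "\<dots> \<le> ennreal (posterior prior n \<omega> (A n)) * ?I n \<omega> (space prior)"
            using E \<omega>(3) by (intro mult_mono ennreal_leI) auto
          also have "\<dots> = ?I n \<omega> (A n)" by (rule elim[symmetric])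
          also have "\<dots> = indicator (space (sample_space M n) - D n) (restrict \<omega> {..<n}) * ?I n \<omega> (A n)"
            using \<omega>(2) restrict_in_sample_space[OF \<omega>(1)] by simp
          finally have "ennreal_powr (ennreal (exp (- real n * (2 * c)))) \<alpha> \<le> ?T n \<omega>"
            using \<alpha> by (rule ennreal_powr_mono)
          also have "ennreal_powr (ennreal (exp (- real n * (2 * c)))) \<alpha> = ennreal (exp (- real n * (\<beta> / 2)))"
            using \<alpha> by (simp add: ennreal_powr_def powr_def c_def field_simps)
          finally have "ennreal (exp (real n * (\<beta> / 2))) * ennreal (exp (- real n * (\<beta> / 2)))
              \<le> ennreal (exp (real n * (\<beta> / 2))) * ?T n \<omega>"
            by (rule mult_left_mono) simp
          with T show False by (simp add: ennreal_mult[symmetric] mult_exp_exp)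
        qed
      qed
      show "?E1 n \<union> ?E2 n \<union> ?E3 n \<in> true_path.events" using E1 E2 elim(1) by (intro sets.Un) auto
    qed
    also have "\<dots> \<le> measure true_path (?E1 n \<union> ?E2 n) + measure true_path (?E3 n)"
      by (rule measure_Un_le[OF sets.Un[OF E1 E2] conjunct2[OF elim(1)]])
    also have "\<dots> \<le> measure true_path (?E1 n) + measure true_path (?E2 n) + measure true_path (?E3 n)"
      by (rule add_right_mono[OF measure_Un_le[OF E1 E2]])
    finally show ?case using elim(1) unfolding sample_prob_def by linarith
  qed
  moreover have "(\<lambda>n. sample_prob M f0 n (D n) + measure true_path (?E2 n) + exp (- \<beta> / 2) ^ n) \<longlonglongrightarrow> 0 + 0 + 0"
  proof (intro tendsto_add LIMSEQ_power_zero)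
    show "(\<lambda>n. sample_prob M f0 n (D n)) \<longlonglongrightarrow> 0" using D by (simp add: vanishing_sets_def)
    show "(\<lambda>n. measure true_path (?E2 n)) \<longlonglongrightarrow> 0" by (rule integrated_ratio_lower_bound[OF kl c])
    show "norm (exp (- \<beta> / 2)) < 1" using \<beta> by simp
  qed
  ultimately show "(\<lambda>n. measure true_path (?E n)) \<longlonglongrightarrow> 0"
    unfolding add_0_right
    by (rule tendsto_sandwich[OF always_eventually[OF allI[OF measure_nonneg]] _ tendsto_const])
qed

text \<open>
  \<open>D n\<close> is enlarged by the samples at which \<open>f0\<close> vanishes: this costs nothing under \<open>f0\<close>, while a
  density \<open>f\<close> may put much mass there that the likelihood ratio does not see.  After the
  enlargement the first moment and the prior average agree.
\<close>

lemma prior_mass_bound_of_moment_bound: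
  assumes A: "\<And>n. n \<ge> 1 \<Longrightarrow> A n \<in> sets prior" and D: "vanishing_sets M f0 D"
    and bound: "\<forall>\<^sub>F n in sequentially. truncated_moment M prior f0 n (A n) (D n) 1 \<le> e n"
  shows "\<exists>D'. vanishing_sets M f0 D' \<and> (\<forall>\<^sub>F n in sequentially.
    (\<integral>\<^sup>+f\<in>A n. ennreal (sample_prob M f n (space (sample_space M n) - D' n)) \<partial>prior) \<le> e n)"
proof (intro exI conjI)
  let ?pos = "\<lambda>n. {x \<in> space (sample_space M n). \<forall>i<n. 0 < f0 (x i)}"
  let ?D' = "\<lambda>n. D n \<union> (space (sample_space M n) - ?pos n)"
  have pos: "?pos n \<in> sets (sample_space M n)" for n
    by (rule sets_all_pos[OF is_density_measurable[OF is_density_true]])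
  have Dn: "D n \<in> sets (sample_space M n)" if "n \<ge> 1" for n
    using D that by (simp add: vanishing_sets_def)
  have D': "?D' n \<in> sets (sample_space M n)" if "n \<ge> 1" for n
    by (rule sets.Un[OF Dn[OF that] sets.compl_sets[OF pos]])
  have "sample_prob M f0 n (?D' n) = sample_prob M f0 n (D n)" if n: "n \<ge> 1" for n
    unfolding sample_prob_def
  proof (rule measure_eq_AE)
    show "AE \<omega> in true_path. \<omega> \<in> {\<omega> \<in> space true_path. restrict \<omega> {..<n} \<in> ?D' n}
        \<longleftrightarrow> \<omega> \<in> {\<omega> \<in> space true_path. restrict \<omega> {..<n} \<in> D n}"
      using AE_path_pos[OF is_density_true, of n] AE_space
    proof eventually_elim
      case (elim \<omega>)
      then have "restrict \<omega> {..<n} \<in> ?pos n" by (simp add: restrict_in_sample_space)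
      then show ?case by blast
    qed
  qed (rule sets_path_event[OF D'[OF n]], rule sets_path_event[OF Dn[OF n]])
  then have "eventually (\<lambda>n. sample_prob M f0 n (D n) = sample_prob M f0 n (?D' n)) sequentially"
    by (intro eventually_sequentiallyI[of 1]) simp
  moreover have "(\<lambda>n. sample_prob M f0 n (D n)) \<longlonglongrightarrow> 0"
    using D by (simp add: vanishing_sets_def)
  ultimately have "(\<lambda>n. sample_prob M f0 n (?D' n)) \<longlonglongrightarrow> 0"
    by (rule Lim_transform_eventually[rotated])
  with D' show "vanishing_sets M f0 ?D'" by (simp add: vanishing_sets_def)
  show "\<forall>\<^sub>F n in sequentially.
    (\<integral>\<^sup>+f\<in>A n. ennreal (sample_prob M f n (space (sample_space M n) - ?D' n)) \<partial>prior) \<le> e n"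
    using bound eventually_ge_at_top[of 1]
  proof eventually_elim
    case (elim n)
    have "space (sample_space M n) - ?D' n
        = {x \<in> space (sample_space M n) - D n. \<forall>i<n. 0 < f0 (x i)}" by blast
    then have "(\<integral>\<^sup>+f\<in>A n. ennreal (sample_prob M f n (space (sample_space M n) - ?D' n)) \<partial>prior)
        = truncated_moment M prior f0 n (A n) (D n) 1"
      unfolding truncated_moment_one
      by (simp only: truncated_integral[OF sets.compl_sets[OF Dn[OF elim(2)]] A[OF elim(2)]])
    with elim(1) show ?case by simp
  qed
qed

text \<open>
  Here the loss in the change of measure goes in the right direction, so the same sets \<open>D n\<close> serve.
\<close>

lemma moment_bound_of_prior_mass_bound:
  assumes A: "\<And>n. n \<ge> 1 \<Longrightarrow> A n \<in> sets prior" and D: "vanishing_sets M f0 D"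
    and bound: "\<forall>\<^sub>F n in sequentially.
      (\<integral>\<^sup>+f\<in>A n. ennreal (sample_prob M f n (space (sample_space M n) - D n)) \<partial>prior) \<le> e n"
  shows "\<forall>\<^sub>F n in sequentially. truncated_moment M prior f0 n (A n) (D n) 1 \<le> e n"
  using bound eventually_ge_at_top[of 1]
proof eventually_elim
  case (elim n)
  let ?C = "space (sample_space M n) - D n"
  have C: "?C \<in> sets (sample_space M n)"
    using D elim(2) by (intro sets.compl_sets) (simp add: vanishing_sets_def)
  have "truncated_moment M prior f0 n (A n) (D n) 1
      = (\<integral>\<^sup>+f\<in>A n. ennreal (sample_prob M f n {x \<in> ?C. \<forall>i<n. 0 < f0 (x i)}) \<partial>prior)"
    unfolding truncated_moment_one by (rule truncated_integral[OF C A[OF elim(2)]])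
  also have "\<dots> \<le> (\<integral>\<^sup>+f\<in>A n. ennreal (sample_prob M f n ?C) \<partial>prior)"
  proof (intro nn_integral_mono mult_right_mono ennreal_leI)
    fix f assume "f \<in> space prior"
    then interpret path: prob_space "path_measure M f"
      by (rule prob_space_path_measure[OF is_density])
    show "sample_prob M f n {x \<in> ?C. \<forall>i<n. 0 < f0 (x i)} \<le> sample_prob M f n ?C"
      unfolding sample_prob_def by (intro path.finite_measure_mono sets_path_event[OF C]) blast
  qed simp
  finally show ?case using elim(1) by simp
qed

end

section \<open>The equivalence\<close>

lemma density_model_hellinger_borel:
  assumes "sigma_finite_measure M" and F: "density_space M F"
    and eval: "(\<lambda>(x, f). f x) \<in> borel_measurable (M \<Otimes>\<^sub>M hellinger_borel M F)"
    and "prob_space prior" and sets: "sets prior = sets (hellinger_borel M F)" and "f0 \<in> F"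
  shows "density_model M prior f0"
proof (rule density_model.intro)
  have "space prior = F"
    using sets_eq_imp_space_eq[OF sets] by (simp add: hellinger_borel_def space_measure_of_conv)
  then show "f \<in> space prior \<Longrightarrow> is_density M f" for f using F by (simp add: density_space_def)
  show "is_density M f0" using F \<open>f0 \<in> F\<close> by (simp add: density_space_def)
  show "(\<lambda>(x, f). f x) \<in> borel_measurable (M \<Otimes>\<^sub>M prior)"
    using eval by (subst measurable_cong_sets[OF sets_pair_measure_cong[OF refl sets] refl])
qed fact+

theorem theorem2:
  fixes M :: "'x::polish_space measure"
    and F :: "('x \<Rightarrow> real) set"
    and prior :: "('x \<Rightarrow> real) measure"
    and f0 :: "'x \<Rightarrow> real"
    and A :: "nat \<Rightarrow> ('x \<Rightarrow> real) set"
  assumes "sigma_finite_measure M"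
    and "space M = UNIV"
    and "density_space M F"
    and "separable_space (hellinger_topology M F)"
    and "(\<lambda>(x, f). f x) \<in> borel_measurable (M \<Otimes>\<^sub>M hellinger_borel M F)"
    and "prob_space prior"
    and "sets prior = sets (hellinger_borel M F)"
    and "f0 \<in> F"
    and "in_kl_support M prior f0"
    and "\<And>n. n \<ge> 1 \<Longrightarrow> A n \<in> sets prior"
  shows
    "let
       i = (\<exists>\<beta>0>0. tendsto_in_prob (path_measure M f0)
                     (\<lambda>n \<omega>. exp (real n * \<beta>0) * posterior prior n \<omega> (A n)) 0);
       ii = (\<exists>\<beta>1>0. (\<lambda>n. measure (path_measure M f0)
                       {\<omega> \<in> space (path_measure M f0).
                          posterior prior n \<omega> (A n) > exp (- real n * \<beta>1)}) \<longlonglongrightarrow> 0);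
       iii = (\<exists>\<alpha>1 \<beta>2 D. 0 < \<alpha>1 \<and> \<alpha>1 \<le> 1 \<and> \<beta>2 > 0 \<and> vanishing_sets M f0 D \<and>
                (\<forall>\<^sub>F n in sequentially.
                   truncated_moment M prior f0 n (A n) (D n) \<alpha>1 \<le> ennreal (exp (- real n * \<beta>2))));
       iv = (\<forall>\<alpha>. 0 < \<alpha> \<and> \<alpha> \<le> 1 \<longrightarrow>
               (\<exists>\<beta>\<alpha> D. \<beta>\<alpha> > 0 \<and> vanishing_sets M f0 D \<and>
                 (\<forall>\<^sub>F n in sequentially.
                    truncated_moment M prior f0 n (A n) (D n) \<alpha> \<le> ennreal (exp (- real n * \<beta>\<alpha>)))));
       v = (\<exists>\<beta>3 D. \<beta>3 > 0 \<and> vanishing_sets M f0 D \<and>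
              (\<forall>\<^sub>F n in sequentially.
                 (\<integral>\<^sup>+f\<in>A n. ennreal (sample_prob M f n (space (sample_space M n) - D n)) \<partial>prior)
                   \<le> ennreal (exp (- real n * \<beta>3))))
     in (i \<longleftrightarrow> ii) \<and> (ii \<longleftrightarrow> iii) \<and> (iii \<longleftrightarrow> iv) \<and> (iv \<longleftrightarrow> v)"
proof -
  interpret density_model M prior f0
    by (rule density_model_hellinger_borel) fact+
  note A = assms(10) and kl = assms(9)
  define ii where "ii \<longleftrightarrow> (\<exists>\<beta>1>0. (\<lambda>n. measure true_path
    {\<omega> \<in> space true_path. posterior prior n \<omega> (A n) > exp (- real n * \<beta>1)}) \<longlonglongrightarrow> 0)"
  define moment where "moment \<alpha> \<longleftrightarrow> (\<exists>\<beta> D. \<beta> > 0 \<and> vanishing_sets M f0 D \<and> (\<forall>\<^sub>F n in sequentially.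
    truncated_moment M prior f0 n (A n) (D n) \<alpha> \<le> ennreal (exp (- real n * \<beta>))))" for \<alpha>
  define v where "v \<longleftrightarrow> (\<exists>\<beta>3 D. \<beta>3 > 0 \<and> vanishing_sets M f0 D \<and> (\<forall>\<^sub>F n in sequentially.
    (\<integral>\<^sup>+f\<in>A n. ennreal (sample_prob M f n (space (sample_space M n) - D n)) \<partial>prior)
      \<le> ennreal (exp (- real n * \<beta>3))))"
  have ii_iv: "moment \<alpha>" if ii "0 < \<alpha>" "\<alpha> \<le> 1" for \<alpha>
    using that moment_bound_of_posterior_decay[of A, OF A] unfolding ii_def moment_def by blast
  have iii_ii: ii if "moment \<alpha>" "0 < \<alpha>" for \<alpha>
    using that posterior_decay_of_moment_bound[of A, OF kl A] unfolding ii_def moment_def by blast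
  have iv_v: v if "moment 1"
  proof -
    from that obtain \<beta> D where D: "\<beta> > 0" "vanishing_sets M f0 D" "\<forall>\<^sub>F n in sequentially.
        truncated_moment M prior f0 n (A n) (D n) 1 \<le> ennreal (exp (- real n * \<beta>))"
      unfolding moment_def by blast
    from prior_mass_bound_of_moment_bound[of A, OF A D(2,3)] D(1) show v
      unfolding v_def by blast
  qed
  have v_iii: "moment 1" if v
  proof -
    from that obtain \<beta> D where D: "\<beta> > 0" "vanishing_sets M f0 D" "\<forall>\<^sub>F n in sequentially.
        (\<integral>\<^sup>+f\<in>A n. ennreal (sample_prob M f n (space (sample_space M n) - D n)) \<partial>prior)
          \<le> ennreal (exp (- real n * \<beta>))"
      unfolding v_def by blast
    from moment_bound_of_prior_mass_bound[of A, OF A D(2,3)] D(1,2) show "moment 1"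
      unfolding moment_def by blast
  qed
  have one: "0 < (1::real)" "(1::real) \<le> 1" by simp_all
  have ii_iff: "ii \<longleftrightarrow> (\<exists>\<alpha>. 0 < \<alpha> \<and> \<alpha> \<le> 1 \<and> moment \<alpha>)"
    using ii_iv[OF _ one] iii_ii one by blast
  have iii_iff: "(\<exists>\<alpha>. 0 < \<alpha> \<and> \<alpha> \<le> 1 \<and> moment \<alpha>) \<longleftrightarrow> (\<forall>\<alpha>. 0 < \<alpha> \<and> \<alpha> \<le> 1 \<longrightarrow> moment \<alpha>)"
    using ii_iv iii_ii one by blast
  have iv_iff: "(\<forall>\<alpha>. 0 < \<alpha> \<and> \<alpha> \<le> 1 \<longrightarrow> moment \<alpha>) \<longleftrightarrow> v"
    using ii_iv iii_ii[OF v_iii one(1)] iv_v one by blast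
  have iii: "(\<exists>\<alpha>1 \<beta>2 D. 0 < \<alpha>1 \<and> \<alpha>1 \<le> 1 \<and> \<beta>2 > 0 \<and> vanishing_sets M f0 D \<and>
      (\<forall>\<^sub>F n in sequentially.
        truncated_moment M prior f0 n (A n) (D n) \<alpha>1 \<le> ennreal (exp (- real n * \<beta>2))))
    \<longleftrightarrow> (\<exists>\<alpha>. 0 < \<alpha> \<and> \<alpha> \<le> 1 \<and> moment \<alpha>)"
    unfolding moment_def by (simp only: ex_simps)
  show ?thesis
    using posterior_decay_iff_tendsto_in_prob[of A, OF A] ii_iff iii_iff iv_iff
    unfolding Let_def iii ii_def moment_def v_def by (intro conjI)
qed

end
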